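(* There exist uncountably many pairwise holomorphically inequivalent (i.e. pairwise non-biholomorphic) non-pseudoconvex Reinhardt domains $D \subset \mathbb{C}^2$ such that $\operatorname{End}(D)$ consists only of rotations, i.e. mappings $D \ni z \mapsto (\omega_1 z_1, \omega_2 z_2) \in D$ with $|\omega_1| = |\omega_2| = 1$, and of constant mappings.
   Context: For a domain $D$, $\operatorname{End}(D)$ denotes the semigroup of all holomorphic self-mappings $D \to D$ under composition. A domain $D \subset \mathbb{C}^n$ is called Reinhardt if $(\omega_1 z_1, \ldots, \omega_n z_n) \in D$ whenever $z \in D$ and $|\omega_1| = \cdots = |\omega_n| = 1$. *)

theory Defs
  imports "HOL-Analysis.Analysis"
begin

definition domain_in_Cn :: "(complex ^ 'n) set \<Rightarrow> bool" where
  "domain_in_Cn D \<longleftrightarrow> open D \<and> connected D \<and> D \<noteq> {}"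

(* Holomorphy is complex Frechet differentiability: the real derivative is multiplication
   by a complex matrix. It is only meant for open D. *)
definition holomorphic_map_on ::
    "(complex ^ 'n \<Rightarrow> complex ^ 'm) \<Rightarrow> (complex ^ 'n) set \<Rightarrow> bool" where
  "holomorphic_map_on f D \<longleftrightarrow>
     (\<forall>z\<in>D. \<exists>A :: complex ^ 'n ^ 'm. (f has_derivative (\<lambda>h. A *v h)) (at z within D))"

(* Self-mappings of D are taken in D \<rightarrow>\<^sub>E D, i.e. they are undefined outside D, so that equality
   of functions is equality of mappings on D. *)
definition holo_End :: "(complex ^ 'n) set \<Rightarrow> (complex ^ 'n \<Rightarrow> complex ^ 'n) set" where
  "holo_End D = {f \<in> D \<rightarrow>\<^sub>E D. holomorphic_map_on f D}"

definition biholomorphic :: "(complex ^ 'n) set \<Rightarrow> (complex ^ 'm) set \<Rightarrow> bool" where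
  "biholomorphic D E \<longleftrightarrow>
     (\<exists>f. bij_betw f D E \<and> holomorphic_map_on f D \<and> holomorphic_map_on (inv_into D f) E)"

definition rotation :: "complex ^ 'n \<Rightarrow> complex ^ 'n \<Rightarrow> complex ^ 'n" where
  "rotation \<omega> z = (\<chi> i. \<omega> $ i * z $ i)"

definition unit_torus :: "(complex ^ 'n) set" where
  "unit_torus = {\<omega>. \<forall>i. cmod (\<omega> $ i) = 1}"

definition Reinhardt :: "(complex ^ 'n) set \<Rightarrow> bool" where
  "Reinhardt D \<longleftrightarrow> (\<forall>z\<in>D. \<forall>\<omega>\<in>unit_torus. rotation \<omega> z \<in> D)"

(* Continuous plurisubharmonic functions: the sub-mean value inequality over every closed
   affine complex disc contained in D (radius absorbed into the direction w). *)
definition continuous_psh_on :: "(complex ^ 'n \<Rightarrow> real) \<Rightarrow> (complex ^ 'n) set \<Rightarrow> bool" where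
  "continuous_psh_on u D \<longleftrightarrow> continuous_on D u \<and>
     (\<forall>z w. (\<forall>\<zeta>. cmod \<zeta> \<le> 1 \<longrightarrow> z + \<zeta> *s w \<in> D) \<longrightarrow>
        u z \<le> 1 / (2 * pi) * integral {0..2 * pi} (\<lambda>t. u (z + cis t *s w)))"

(* Pseudoconvexity of an open set: existence of a continuous plurisubharmonic exhaustion function,
   i.e. one whose sublevel sets are relatively compact in D. *)
definition pseudoconvex :: "(complex ^ 'n) set \<Rightarrow> bool" where
  "pseudoconvex D \<longleftrightarrow>
     (\<exists>u. continuous_psh_on u D \<and>
        (\<forall>c. compact (closure {z \<in> D. u z < c}) \<and> closure {z \<in> D. u z < c} \<subseteq> D))"

end

theory Submission
  imports Defs "HOL-Complex_Analysis.Complex_Analysis" "HOL-Real_Asymp.Real_Asymp"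
begin

text \<open>
  Fix \<open>\<alpha> > 0\<close> that is neither rational nor quadratic, and put \<open>t = ln \<bar>z\<^sub>1\<bar> + \<alpha> ln \<bar>z\<^sub>2\<bar>\<close>,
  \<open>y = ln \<bar>z\<^sub>2\<bar>\<close>. The domain \<open>D\<^sub>p\<close> lies over a Z-shaped part of the strip \<open>0 < t < 1\<close>: over
  \<open>t < p\<close> it is bounded in the direction \<open>y \<rightarrow> +\<infinity>\<close>, over \<open>t > p\<close> in the direction \<open>y \<rightarrow> -\<infinity>\<close>.
  Laurent coefficients of a holomorphic function are the same on all tori of \<open>D\<^sub>p\<close>, and since
  every nonconstant Laurent monomial is unbounded at an end of the strip, a one-sided bound on
  the real part that grows linearly in \<open>y\<close> at both ends makes the function constant.

  A holomorphic map \<open>F : D\<^sub>p \<rightarrow> D\<^sub>q\<close> has components \<open>exp (m\<^sub>j w\<^sub>1 + n\<^sub>j w\<^sub>2 + P\<^sub>j)\<close> in logarithmic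
  coordinates with integers \<open>m\<^sub>j, n\<^sub>j\<close> and periodic \<open>P\<^sub>j\<close>. The value of \<open>t\<close> at \<open>F\<close> is bounded, so
  \<open>P\<^sub>1 + \<alpha> P\<^sub>2\<close> is constant, and the choice of \<open>\<alpha>\<close> forces the integer matrix to be \<open>k\<close> times the
  identity. Then each leaf \<open>t = const\<close> is mapped into a leaf, on which \<open>y\<close> is bounded on one side, so
  \<open>P\<^sub>2\<close> is constant too. Hence \<open>F\<close> is affine in \<open>(t, y)\<close> with factor \<open>k\<close>, and the Z-shape
  leaves only constants and, for \<open>p = q\<close>, rotations. In particular the \<open>D\<^sub>p\<close> with \<open>0 < p < 1/2\<close> are
  pairwise inequivalent. The reentrant corner of the Z violates the continuity principle.
\<close>

section \<open>Fourier coefficients on the torus\<close>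

text \<open>The closed square carries both copies of each edge, so that compactness and
  \<open>cbox\<close> integrals are available. The gluing of opposite edges reappears as the
  periodicity hypothesis of \<open>torus_fourier_unique\<close>.\<close>

definition torus_box :: "(real \<times> real) set" where
  "torus_box = cbox (0, 0) (2 * pi, 2 * pi)"

definition torus_char :: "int \<Rightarrow> int \<Rightarrow> real \<times> real \<Rightarrow> complex" where
  "torus_char m n \<theta> = cis (of_int m * fst \<theta> + of_int n * snd \<theta>)"

lemma mem_torus_box: "\<theta> \<in> torus_box \<longleftrightarrow> fst \<theta> \<in> {0..2*pi} \<and> snd \<theta> \<in> {0..2*pi}"
  unfolding torus_box_def by (cases \<theta>) (auto simp: cbox_Pair_eq)

lemma compact_torus_box: "compact torus_box"
  unfolding torus_box_def by (rule compact_cbox)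

lemma integrable_on_torus_box:
  fixes f :: "real \<times> real \<Rightarrow> 'a::banach"
  shows "continuous_on torus_box f \<Longrightarrow> f integrable_on torus_box"
  unfolding torus_box_def by (rule integrable_continuous)

lemma continuous_on_torus_char [continuous_intros]: "continuous_on A (torus_char m n)"
  unfolding torus_char_def by (intro continuous_intros)

lemma torus_char_mult: "torus_char m n \<theta> * torus_char k l \<theta> = torus_char (m + k) (n + l) \<theta>"
  by (simp add: torus_char_def cis_mult algebra_simps)

text \<open>Euler's formulas: on the torus a real-linear functional is a combination of two sines
  and two cosines, hence of the four characters of degree one. This is the base case of the
  induction over polynomials.\<close>

lemma bounded_linear_on_torus:
  fixes f :: "complex \<times> complex \<Rightarrow> real"
  assumes "bounded_linear f"
  obtains a b c d :: complex where
    "\<And>\<theta>. of_real (f (cis (fst \<theta>), cis (snd \<theta>))) =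
      a * torus_char 1 0 \<theta> + b * torus_char (-1) 0 \<theta> + c * torus_char 0 1 \<theta> + d * torus_char 0 (-1) \<theta>"
proof -
  interpret bounded_linear f by fact
  define a1 a2 a3 a4 where "a1 = f (1,0)" "a2 = f (\<i>,0)" "a3 = f (0,1)" "a4 = f (0,\<i>)"
  have *: "(cis s, cis t) = cos s *\<^sub>R (1,0) + sin s *\<^sub>R (\<i>,0) + cos t *\<^sub>R (0,1) + sin t *\<^sub>R (0,\<i>)" for s t
    by (simp add: complex_eq_iff)
  have f: "f (cis s, cis t) = cos s * a1 + sin s * a2 + cos t * a3 + sin t * a4" for s t
    unfolding * by (simp only: add scaleR a1_a2_a3_a4_def real_scaleR_def)
  show thesis
    by (rule that[of "(a1 - \<i> * a2)/2" "(a1 + \<i> * a2)/2" "(a3 - \<i> * a4)/2" "(a3 + \<i> * a4)/2"])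
      (simp add: f torus_char_def complex_eq_iff field_simps)
qed

lemma continuous_on_polynomial_torus:
  fixes h :: "complex \<times> complex \<Rightarrow> 'a::euclidean_space"
  assumes "polynomial_function h"
  shows "continuous_on A (\<lambda>\<theta>. h (cis (fst \<theta>), cis (snd \<theta>)))"
proof -
  have "continuous_on A (\<lambda>\<theta>. (cis (fst \<theta>), cis (snd \<theta>)))"
    by (intro continuous_intros)
  from continuous_on_compose2[OF continuous_on_polymonial_function[OF assms, of UNIV] this]
  show ?thesis by simp
qed

text \<open>Multiplying by a coordinate shifts Fourier indices by one, so vanishing of all
  coefficients survives. \<open>\<phi>\<close> stays arbitrary in the induction because a product is
  treated by first absorbing one factor into \<open>\<phi>\<close>.\<close>

lemma torus_coeffs_mult_polynomial:
  fixes \<phi> :: "real \<times> real \<Rightarrow> complex"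
  assumes "real_polynomial_function p" and "continuous_on torus_box \<phi>"
    and "\<And>m n. integral torus_box (\<lambda>\<theta>. \<phi> \<theta> * torus_char m n \<theta>) = 0"
  shows "integral torus_box (\<lambda>\<theta>. \<phi> \<theta> * of_real (p (cis (fst \<theta>), cis (snd \<theta>))) * torus_char m n \<theta>) = 0"
  using assms
proof (induction p arbitrary: \<phi> m n rule: real_polynomial_function.induct)
  case (linear f)
  obtain a b c d where f: "\<And>\<theta>. of_real (f (cis (fst \<theta>), cis (snd \<theta>))) =
      a * torus_char 1 0 \<theta> + b * torus_char (-1) 0 \<theta> + c * torus_char 0 1 \<theta> + d * torus_char 0 (-1) \<theta>"
    using bounded_linear_on_torus[OF linear(1)] by blast
  have shift: "torus_char 1 0 \<theta> * torus_char m n \<theta> = torus_char (1 + m) n \<theta>"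
    "torus_char (-1) 0 \<theta> * torus_char m n \<theta> = torus_char (-1 + m) n \<theta>"
    "torus_char 0 1 \<theta> * torus_char m n \<theta> = torus_char m (1 + n) \<theta>"
    "torus_char 0 (-1) \<theta> * torus_char m n \<theta> = torus_char m (-1 + n) \<theta>" for \<theta>
    by (simp_all only: torus_char_mult add_0)
  have int: "((\<lambda>\<theta>. c * (\<phi> \<theta> * torus_char m n \<theta>)) has_integral c * 0) torus_box" for c m n
  proof -
    have "(\<lambda>\<theta>. \<phi> \<theta> * torus_char m n \<theta>) integrable_on torus_box"
      by (intro integrable_on_torus_box continuous_intros linear(2))
    from has_integral_mult_right[OF integrable_integral[OF this]] show ?thesis
      by (simp only: linear(3))
  qed
  have "((\<lambda>\<theta>. a * (\<phi> \<theta> * torus_char (1+m) n \<theta>) + b * (\<phi> \<theta> * torus_char (-1+m) n \<theta>)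
      + c * (\<phi> \<theta> * torus_char m (1+n) \<theta>) + d * (\<phi> \<theta> * torus_char m (-1+n) \<theta>))
      has_integral a * 0 + b * 0 + c * 0 + d * 0) torus_box"
    by (intro has_integral_add int)
  moreover have "a * (\<phi> \<theta> * torus_char (1+m) n \<theta>) + b * (\<phi> \<theta> * torus_char (-1+m) n \<theta>)
      + c * (\<phi> \<theta> * torus_char m (1+n) \<theta>) + d * (\<phi> \<theta> * torus_char m (-1+n) \<theta>)
      = \<phi> \<theta> * of_real (f (cis (fst \<theta>), cis (snd \<theta>))) * torus_char m n \<theta>" for \<theta>
    unfolding f shift[symmetric] by (simp only: algebra_simps)
  ultimately show ?case
    by (simp only: mult_zero_right add_0 integral_unique)
next
  case (const c)
  have "integral torus_box (\<lambda>\<theta>. of_real c * (\<phi> \<theta> * torus_char m n \<theta>)) = 0"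
    using const(2) by (simp only: integral_mult_right mult_zero_right)
  then show ?case
    by (simp only: mult.commute mult.left_commute)
next
  case (add f g)
  have int: "(\<lambda>\<theta>. \<phi> \<theta> * of_real (h (cis (fst \<theta>), cis (snd \<theta>))) * torus_char m n \<theta>) integrable_on torus_box"
    if "real_polynomial_function h" for h
  proof -
    have "polynomial_function h"
      using that by (simp only: real_polynomial_function_eq)
    then have "continuous_on torus_box (\<lambda>\<theta>. h (cis (fst \<theta>), cis (snd \<theta>)))"
      by (rule continuous_on_polynomial_torus)
    then show ?thesis
      by (intro integrable_on_torus_box continuous_intros add(5))
  qed
  have "((\<lambda>\<theta>. \<phi> \<theta> * of_real (f (cis (fst \<theta>), cis (snd \<theta>))) * torus_char m n \<theta>
       + \<phi> \<theta> * of_real (g (cis (fst \<theta>), cis (snd \<theta>))) * torus_char m n \<theta>) has_integral 0 + 0) torus_box"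
    using has_integral_add[OF integrable_integral[OF int[OF add(1)]] integrable_integral[OF int[OF add(2)]]]
    by (simp only: add(3)[OF add(5,6)] add(4)[OF add(5,6)])
  then show ?case
    by (simp only: integral_unique of_real_add distrib_left distrib_right add_0)
next
  case (mult f g)
  have "polynomial_function f"
    using mult(1) by (simp only: real_polynomial_function_eq)
  then have "continuous_on torus_box (\<lambda>\<theta>. f (cis (fst \<theta>), cis (snd \<theta>)))"
    by (rule continuous_on_polynomial_torus)
  then have "continuous_on torus_box (\<lambda>\<theta>. \<phi> \<theta> * of_real (f (cis (fst \<theta>), cis (snd \<theta>))))"
    by (intro continuous_intros mult(5))
  from mult(4)[OF this mult(3)[OF mult(5,6)]] show ?case
    by (simp only: of_real_mult mult.assoc)
qed

text \<open>A polynomial \<open>g\<close> uniformly close to \<open>\<phi>\<close> on the torus has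
  a conjugate orthogonal to \<open>\<phi>\<close> under the bilinear integral pairing. Hence the
  integral of the squared modulus of \<open>\<phi>\<close> equals that of \<open>\<phi>\<close>
  times the conjugate of the small error, and must be 0.\<close>

lemma torus_fourier_unique:
  fixes \<phi> :: "real \<times> real \<Rightarrow> complex"
  assumes cont: "continuous_on torus_box \<phi>"
    and per: "\<And>s. s \<in> {0..2*pi} \<Longrightarrow> \<phi> (0, s) = \<phi> (2*pi, s)" "\<And>s. s \<in> {0..2*pi} \<Longrightarrow> \<phi> (s, 0) = \<phi> (s, 2*pi)"
    and coeff: "\<And>m n. integral torus_box (\<lambda>\<theta>. \<phi> \<theta> * torus_char m n \<theta>) = 0"
    and \<theta>: "\<theta> \<in> torus_box"
  shows "\<phi> \<theta> = 0"
proof -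
  define T where "T = (sphere 0 1 :: complex set) \<times> (sphere 0 1 :: complex set)"
  define q where "q = (\<lambda>\<theta>::real\<times>real. (cis (fst \<theta>), cis (snd \<theta>)))"
  define \<psi> where "\<psi> = (\<lambda>z. \<phi> (Arg2pi (fst z), Arg2pi (snd z)))"
  have Arg_cis: "Arg2pi (cis s) = (if s = 2*pi then 0 else s)" if "s \<in> {0..2*pi}" for s
    using that Arg2pi_unique[of 1 s "cis s"] Arg2pi_of_real[of 1] by (auto simp: cis_conv_exp[symmetric])
  \<comment> \<open>\<open>Arg2pi\<close> returns 0 where the square has 2 pi. The edges need one
    periodicity hypothesis, the far corner both.\<close>
  have \<psi>q: "\<psi> (q \<theta>) = \<phi> \<theta>" if th: "\<theta> \<in> torus_box" for \<theta>
  proof -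
    obtain s t where st: "\<theta> = (s, t)" "s \<in> {0..2*pi}" "t \<in> {0..2*pi}"
      using th[unfolded mem_torus_box] by (metis prod.collapse)
    have "(0::real) \<in> {0..2*pi}" "2*pi \<in> {0..2*pi}" by auto
    then show ?thesis
      using per(1)[OF st(3)] per(2)[OF st(2)] per(2)[of 0] per(1)[of 0]
      unfolding \<psi>_def q_def st(1) fst_conv snd_conv Arg_cis[OF st(2)] Arg_cis[OF st(3)] by presburger
  qed
  have contq: "continuous_on torus_box q"
    unfolding q_def by (intro continuous_intros)
  have ex: "\<exists>s\<in>{0..2*pi}. z = cis s" if "cmod z = 1" for z
  proof (intro bexI[of _ "Arg2pi z"])
    show "z = cis (Arg2pi z)"
      using that Arg2pi_eq[of z] by (metis cis_conv_exp mult_1 of_real_1)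
  qed (use Arg2pi_ge_0[of z] Arg2pi_lt_2pi[of z] in auto)
  have qT: "q ` torus_box = T"
  proof
    show "q ` torus_box \<subseteq> T" by (auto simp: q_def T_def)
    show "T \<subseteq> q ` torus_box"
    proof
      fix z assume "z \<in> T"
      then have "cmod (fst z) = 1" "cmod (snd z) = 1" by (auto simp: T_def)
      then obtain s t where "s \<in> {0..2*pi}" "t \<in> {0..2*pi}" "fst z = cis s" "snd z = cis t"
        using ex by meson
      then show "z \<in> q ` torus_box"
        by (intro image_eqI[of _ _ "(s, t)"]) (auto simp: q_def mem_torus_box prod_eq_iff)
    qed
  qed
  \<comment> \<open>The compact square has the torus as topological quotient, so \<open>\<phi>\<close> descends to it and Stone--Weierstrass applies there.\<close>
  have "continuous_on T \<psi>"
    unfolding continuous_openin_preimage_eq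
  proof (intro allI impI)
    fix U :: "complex set" assume "open U"
    have "x \<in> torus_box \<inter> q -` (T \<inter> \<psi> -` U) \<longleftrightarrow> x \<in> torus_box \<inter> \<phi> -` U" for x
      using \<psi>q[of x] qT by (cases "x \<in> torus_box") auto
    then have "torus_box \<inter> q -` (T \<inter> \<psi> -` U) = torus_box \<inter> \<phi> -` U"
      by blast
    moreover have "openin (top_of_set torus_box) (torus_box \<inter> \<phi> -` U)"
      using cont \<open>open U\<close> by (simp add: continuous_openin_preimage_gen)
    ultimately show "openin (top_of_set T) (T \<inter> \<psi> -` U)"
      using Abstract_Topology_2.continuous_imp_quotient_map[OF contq qT compact_torus_box, of "T \<inter> \<psi> -` U"] by simp
  qed
  moreover have "compact T"
    unfolding T_def by (intro compact_Times) auto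
  ultimately have approx: "\<exists>g. polynomial_function g \<and> (\<forall>z\<in>T. cmod (\<psi> z - g z) < e)" if "e > 0" for e
    using Stone_Weierstrass_polynomial_function that by blast
  have "bounded (\<phi> ` torus_box)"
    by (intro compact_imp_bounded compact_continuous_image cont compact_torus_box)
  then obtain B where B: "B > 0" "\<And>\<theta>. \<theta> \<in> torus_box \<Longrightarrow> cmod (\<phi> \<theta>) \<le> B"
    unfolding bounded_pos by auto
  let ?I = "integral torus_box (\<lambda>\<theta>. \<phi> \<theta> * cnj (\<phi> \<theta>))"
  have "cmod ?I \<le> B * e * measure lborel torus_box" if e: "e > 0" for e
  proof -
    obtain g where g: "polynomial_function g" "\<And>z. z \<in> T \<Longrightarrow> cmod (\<psi> z - g z) < e"
      using approx[OF e] by blast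
    have pol: "real_polynomial_function (\<lambda>z. Re (g z))" "real_polynomial_function (\<lambda>z. Im (g z))"
      using g(1) bounded_linear_Re bounded_linear_Im unfolding polynomial_function_def o_def by blast+
    have contg: "continuous_on torus_box (\<lambda>\<theta>. g (q \<theta>))"
      by (rule continuous_on_compose2[OF continuous_on_polymonial_function[OF g(1)] contq]) auto
    have "integral torus_box (\<lambda>\<theta>. \<phi> \<theta> * of_real (Re (g (q \<theta>)))) = 0"
         "integral torus_box (\<lambda>\<theta>. \<phi> \<theta> * of_real (Im (g (q \<theta>)))) = 0"
      using torus_coeffs_mult_polynomial[OF pol(1) cont coeff, of 0 0]
         torus_coeffs_mult_polynomial[OF pol(2) cont coeff, of 0 0]
      by (auto simp: torus_char_def q_def)
    moreover have "\<phi> \<theta> * cnj (g (q \<theta>)) = \<phi> \<theta> * of_real (Re (g (q \<theta>))) - \<i> * (\<phi> \<theta> * of_real (Im (g (q \<theta>))))" for \<theta>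
      by (simp add: complex_eq_iff)
    moreover have "(\<lambda>\<theta>. \<phi> \<theta> * of_real (Re (g (q \<theta>)))) integrable_on torus_box"
       "(\<lambda>\<theta>. \<i> * (\<phi> \<theta> * of_real (Im (g (q \<theta>))))) integrable_on torus_box"
      by (intro integrable_on_torus_box continuous_intros cont contg)+
    ultimately have "integral torus_box (\<lambda>\<theta>. \<phi> \<theta> * cnj (g (q \<theta>))) = 0"
      by (simp add: integral_diff)
    moreover have "(\<lambda>\<theta>. \<phi> \<theta> * cnj (g (q \<theta>))) integrable_on torus_box" "(\<lambda>\<theta>. \<phi> \<theta> * cnj (\<phi> \<theta>)) integrable_on torus_box"
      by (intro integrable_on_torus_box continuous_intros cont contg)+
    ultimately have "?I = integral torus_box (\<lambda>\<theta>. \<phi> \<theta> * cnj (\<phi> \<theta> - g (q \<theta>)))"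
      by (simp add: integral_diff algebra_simps)
    also have "cmod \<dots> \<le> B * e * measure lborel torus_box"
      unfolding torus_box_def
    proof (rule has_integral_bound)
      show "((\<lambda>\<theta>. \<phi> \<theta> * cnj (\<phi> \<theta> - g (q \<theta>))) has_integral integral (cbox (0,0) (2*pi,2*pi)) (\<lambda>\<theta>. \<phi> \<theta> * cnj (\<phi> \<theta> - g (q \<theta>)))) (cbox (0,0) (2*pi,2*pi))"
        unfolding torus_box_def[symmetric] has_integral_integral[symmetric]
        by (intro integrable_on_torus_box continuous_intros cont contg)
      fix \<theta> assume "\<theta> \<in> cbox (0,0) (2*pi,2*pi)"
      then have \<theta>: "\<theta> \<in> torus_box" by (simp add: torus_box_def)
      then have "q \<theta> \<in> T" using qT by blast
      with g(2)[of "q \<theta>"] \<psi>q[OF \<theta>] B(2)[OF \<theta>] B(1) \<open>e > 0\<close>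
      show "cmod (\<phi> \<theta> * cnj (\<phi> \<theta> - g (q \<theta>))) \<le> B * e"
        by (simp only: norm_mult complex_mod_cnj) (intro mult_mono; simp)
    qed (use B \<open>e > 0\<close> in auto)
    finally show ?thesis .
  qed
  note bnd = this
  have "cmod ?I \<le> 0 + e" if "e > 0" for e
  proof -
    have "0 \<le> B * measure lborel torus_box" using B by (simp add: torus_box_def)
    then have "0 < B * measure lborel torus_box + 1" by linarith
    \<comment> \<open>The tolerance is rescaled to absorb the constant factor; the summand 1 makes
      the denominator positive.\<close>
    then have "cmod ?I \<le> B * (e / (B * measure lborel torus_box + 1)) * measure lborel torus_box"
      using that by (intro bnd) auto
    also have "\<dots> = e * (B * measure lborel torus_box / (B * measure lborel torus_box + 1))"
      by simp
    also have "\<dots> \<le> e * 1"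
      using that \<open>0 < B * measure lborel torus_box + 1\<close> by (intro mult_left_mono) auto
    finally show ?thesis by simp
  qed
  then have "?I = 0"
    using field_le_epsilon[of "cmod ?I" 0] by simp
  moreover have "integral torus_box (Re \<circ> (\<lambda>\<theta>. \<phi> \<theta> * cnj (\<phi> \<theta>))) = Re ?I"
    by (intro integral_linear integrable_on_torus_box continuous_intros cont bounded_linear_Re)
  moreover have "(Re \<circ> (\<lambda>\<theta>. \<phi> \<theta> * cnj (\<phi> \<theta>))) = (\<lambda>\<theta>. (cmod (\<phi> \<theta>))\<^sup>2)"
    by (simp add: fun_eq_iff cmod_def power2_eq_square)
  ultimately have I0: "integral torus_box (\<lambda>\<theta>. (cmod (\<phi> \<theta>))\<^sup>2) = 0"
    by simp
  have "(cmod (\<phi> \<theta>))\<^sup>2 = 0"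
  proof (rule ccontr)
    assume ne: "(cmod (\<phi> \<theta>))\<^sup>2 \<noteq> 0"
    have "continuous_on (cbox (0,0) (2*pi,2*pi)) (\<lambda>\<theta>. (cmod (\<phi> \<theta>))\<^sup>2)"
      using cont unfolding torus_box_def by (intro continuous_intros)
    moreover have "box (0::real, 0::real) (2*pi, 2*pi) \<noteq> {}"
      using pi_gt_zero by (simp add: box_eq_empty Basis_prod_def) (meson not_le pi_gt_zero)
    ultimately have "\<forall>x \<in> torus_box. (cmod (\<phi> x))\<^sup>2 = 0"
      using integral_cbox_eq_0_iff[of "(0,0)" "(2*pi,2*pi)" "\<lambda>\<theta>. (cmod (\<phi> \<theta>))\<^sup>2"] I0[unfolded torus_box_def]
      unfolding torus_box_def by (metis zero_le_power2)
    with \<theta> ne show False by simp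
  qed
  then show ?thesis by simp
qed

section \<open>Laurent coefficients on tube domains\<close>

definition tube :: "(real \<times> real) set \<Rightarrow> (complex \<times> complex) set" where
  "tube X = {w. (Re (fst w), Re (snd w)) \<in> X}"

definition torus_point :: "real \<times> real \<Rightarrow> real \<times> real \<Rightarrow> complex \<times> complex" where
  "torus_point x \<theta> = (Complex (fst x) (fst \<theta>), Complex (snd x) (snd \<theta>))"

text \<open>Joint holomorphy is encoded as continuity plus holomorphy in each variable (equivalent
  on open tubes by Osgood's lemma), so that one-variable theorems apply directly. With the two
  periods, these are holomorphic functions on the Reinhardt domain written in logarithmic
  coordinates.\<close>

definition periodic_holo :: "(real \<times> real) set \<Rightarrow> (complex \<times> complex \<Rightarrow> complex) \<Rightarrow> bool" where
  "periodic_holo X K \<longleftrightarrow> continuous_on (tube X) K \<and>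
     (\<forall>v. (\<lambda>u. K (u, v)) holomorphic_on {u. (u, v) \<in> tube X}) \<and>
     (\<forall>u. (\<lambda>v. K (u, v)) holomorphic_on {v. (u, v) \<in> tube X}) \<and>
     (\<forall>u v. (u, v) \<in> tube X \<longrightarrow>
        K (u + 2 * of_real pi * \<i>, v) = K (u, v) \<and> K (u, v + 2 * of_real pi * \<i>) = K (u, v))"

text \<open>Not normalised: the constant 1 has mean (2 pi)^2.\<close>

definition torus_mean :: "(complex \<times> complex \<Rightarrow> complex) \<Rightarrow> real \<times> real \<Rightarrow> complex" where
  "torus_mean K x = integral torus_box (\<lambda>\<theta>. K (torus_point x \<theta>))"

lemma torus_point_in_tube: "torus_point x \<theta> \<in> tube X \<longleftrightarrow> x \<in> X"
  by (simp add: torus_point_def tube_def)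

lemma continuous_on_Complex [continuous_intros]:
  "continuous_on A f \<Longrightarrow> continuous_on A g \<Longrightarrow> continuous_on A (\<lambda>x. Complex (f x) (g x))"
  unfolding Complex_eq by (intro continuous_intros)

lemma continuous_on_torus_point:
  assumes "continuous_on (tube X) K" "x \<in> X"
  shows "continuous_on A (\<lambda>\<theta>. K (torus_point x \<theta>))"
proof (rule continuous_on_compose2[OF assms(1)])
  show "continuous_on A (torus_point x)"
    unfolding torus_point_def by (intro continuous_intros)
qed (use assms in \<open>auto simp: torus_point_in_tube\<close>)

text \<open>Differentiating under the integral in the real direction gives the integral of
  \<open>deriv k\<close> along one vertical period. This is -i times the increment of
  \<open>k\<close> over a period, hence 0.\<close>

lemma vertical_mean_const:
  assumes k: "k holomorphic_on {w. a < Re w \<and> Re w < b}"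
    and per: "\<And>w. a < Re w \<Longrightarrow> Re w < b \<Longrightarrow> k (w + 2 * of_real pi * \<i>) = k w"
    and x: "a < x" "x < b" "a < x'" "x' < b"
  shows "integral {0..2*pi} (\<lambda>t. k (Complex x t)) = integral {0..2*pi} (\<lambda>t. k (Complex x' t))"
proof -
  define U where "U = {w. a < Re w \<and> Re w < b}"
  have openU: "open U"
    unfolding U_def by (intro open_Collect_conj open_halfspace_Re_gt open_halfspace_Re_lt)
  have der: "(k has_field_derivative deriv k w) (at w)" if "w \<in> U" for w
    using holomorphic_derivI[OF k[folded U_def] openU that] .
  have contd: "continuous_on U (deriv k)"
    by (intro holomorphic_on_imp_continuous_on holomorphic_deriv k[folded U_def] openU)
  have contk: "continuous_on U k"
    by (intro holomorphic_on_imp_continuous_on k[folded U_def])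
  have "((\<lambda>x. integral (cbox 0 (2*pi)) (\<lambda>t. k (Complex x t))) has_vector_derivative 0) (at x within {a<..<b})"
    if x: "x \<in> {a<..<b}" for x
  proof -
    have "((\<lambda>x. integral (cbox 0 (2*pi)) (\<lambda>t. k (Complex x t))) has_vector_derivative
        integral (cbox 0 (2*pi)) (\<lambda>t. deriv k (Complex x t))) (at x within {a<..<b})"
    proof (rule leibniz_rule_vector_derivative)
      fix y t assume y: "y \<in> {a<..<b}"
      have "((\<lambda>y. Complex y t) has_vector_derivative 1) (at y within {a<..<b})"
        unfolding Complex_eq by (auto intro!: derivative_eq_intros)
      from field_vector_diff_chain_within[OF this DERIV_subset[OF der[of "Complex y t"] subset_UNIV]] y
      show "((\<lambda>y. k (Complex y t)) has_vector_derivative deriv k (Complex y t)) (at y within {a<..<b})"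
        by (simp add: o_def U_def)
    next
      fix y assume "y \<in> {a<..<b}"
      then have "continuous_on {0..2*pi} (\<lambda>t. k (Complex y t))"
        by (intro continuous_on_compose2[OF contk] continuous_intros) (auto simp: U_def)
      then show "(\<lambda>t. k (Complex y t)) integrable_on cbox 0 (2*pi)"
        by (simp add: integrable_continuous_real)
    next
      show "continuous_on ({a<..<b} \<times> cbox 0 (2*pi)) (\<lambda>(x, t). deriv k (Complex x t))"
        unfolding split_def
        by (intro continuous_on_compose2[OF contd] continuous_intros) (auto simp: U_def)
    qed (use x in auto)
    moreover have "((\<lambda>t. deriv k (Complex x t)) has_integral
        (- \<i> * k (Complex x (2*pi)) - (- \<i> * k (Complex x 0)))) {0..2*pi}"
    proof (rule fundamental_theorem_of_calculus)
      fix t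
      have "((\<lambda>t. Complex x t) has_vector_derivative \<i>) (at t within {0..2*pi})"
        unfolding Complex_eq by (auto intro!: derivative_eq_intros)
      from field_vector_diff_chain_within[OF this DERIV_subset[OF der[of "Complex x t"] subset_UNIV]] x
      have "((\<lambda>t. k (Complex x t)) has_vector_derivative \<i> * deriv k (Complex x t)) (at t within {0..2*pi})"
        by (simp add: o_def U_def)
      from has_vector_derivative_mult_right[OF this, of "-\<i>"]
      show "((\<lambda>t. - \<i> * k (Complex x t)) has_vector_derivative deriv k (Complex x t)) (at t within {0..2*pi})"
        by (simp flip: mult.assoc)
    qed simp
    moreover have "k (Complex x (2*pi)) = k (Complex x 0)"
    proof -
      have "Complex x (2*pi) = Complex x 0 + 2 * of_real pi * \<i>" by (simp add: complex_eq_iff)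
      then show ?thesis using per[of "Complex x 0"] x by simp
    qed
    ultimately show ?thesis by (simp add: integral_unique)
  qed
  then obtain c where "\<And>x. x \<in> {a<..<b} \<Longrightarrow> integral (cbox 0 (2*pi)) (\<lambda>t. k (Complex x t)) = c"
    using has_vector_derivative_zero_constant[of "{a<..<b}"] by (metis convex_real_interval(8))
  with x show ?thesis by simp
qed

text \<open>By connectedness, local constancy suffices. Inside a small product box one coordinate is
  moved at a time, each by the one-variable lemma under an iterated integral.\<close>

lemma torus_mean_const:
  assumes K: "periodic_holo X K" and X: "open X" "connected X" and xy: "x \<in> X" "y \<in> X"
  shows "torus_mean K x = torus_mean K y"
proof (rule connected_local_const[OF X(2) xy, of "torus_mean K"], intro ballI)
  fix z assume z: "z \<in> X"
  obtain A B where AB: "open A" "open B" "z \<in> A \<times> B" "A \<times> B \<subseteq> X"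
    using open_prod_elim[OF X(1) z] by metis
  obtain e1 where e1: "e1 > 0" "ball (fst z) e1 \<subseteq> A"
    using AB by (metis openE mem_Times_iff)
  obtain e2 where e2: "e2 > 0" "ball (snd z) e2 \<subseteq> B"
    using AB by (metis openE mem_Times_iff)
  have cont: "continuous_on (cbox (0,0) (2*pi,2*pi)) (\<lambda>\<theta>. K (torus_point w \<theta>))" if "w \<in> X" for w
    using K that continuous_on_torus_point unfolding periodic_holo_def by blast
  have "torus_mean K w = torus_mean K z" if w: "w \<in> ball (fst z) e1 \<times> ball (snd z) e2" for w
  proof -
    \<comment> \<open>The corner on the path from \<open>w\<close> to \<open>z\<close>; continuity
      over its torus permits the exchange of the order of integration.\<close>
    define w' where "w' = (fst w, snd z)"
    have mem: "\<And>x y. x \<in> ball (fst z) e1 \<Longrightarrow> y \<in> ball (snd z) e2 \<Longrightarrow> (x, y) \<in> X"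
      using e1 e2 AB by blast
    have w'X: "w' \<in> X" "w \<in> X" using w e2 mem[of "fst w" "snd w"] mem[of "fst w" "snd z"] by (auto simp: w'_def mem_Times_iff)
    have "torus_mean K w = integral (cbox 0 (2*pi)) (\<lambda>s. integral (cbox 0 (2*pi)) (\<lambda>t. K (Complex (fst w) s, Complex (snd w) t)))"
      unfolding torus_mean_def torus_box_def
      by (subst integral_prod_continuous[OF cont[OF w'X(2)]]) (simp add: torus_point_def)
    also have "\<dots> = integral (cbox 0 (2*pi)) (\<lambda>s. integral (cbox 0 (2*pi)) (\<lambda>t. K (Complex (fst w) s, Complex (snd z) t)))"
    proof (rule integral_cong)
      fix s
      have sub: "(Complex (fst w) s, v) \<in> tube X" if "snd z - e2 < Re v" "Re v < snd z + e2" for v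
        using that mem[of "fst w" "Re v"] w by (auto simp: tube_def dist_real_def mem_Times_iff)
      have "(\<lambda>v. K (Complex (fst w) s, v)) holomorphic_on {v. (Complex (fst w) s, v) \<in> tube X}"
        using K unfolding periodic_holo_def by blast
      then have hol: "(\<lambda>v. K (Complex (fst w) s, v)) holomorphic_on {v. snd z - e2 < Re v \<and> Re v < snd z + e2}"
        by (rule holomorphic_on_subset) (use sub in auto)
      have per: "K (Complex (fst w) s, v + 2 * of_real pi * \<i>) = K (Complex (fst w) s, v)"
        if "snd z - e2 < Re v" "Re v < snd z + e2" for v
        using K sub[OF that] unfolding periodic_holo_def by blast
      have "snd z - e2 < snd w" "snd w < snd z + e2" "snd z - e2 < snd z" "snd z < snd z + e2"
        using w e2 by (auto simp: mem_Times_iff dist_real_def abs_less_iff)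
      from vertical_mean_const[OF hol per this]
      show "integral (cbox 0 (2*pi)) (\<lambda>t. K (Complex (fst w) s, Complex (snd w) t)) = integral (cbox 0 (2*pi)) (\<lambda>t. K (Complex (fst w) s, Complex (snd z) t))"
        by simp
    qed
    also have "\<dots> = integral (cbox 0 (2*pi)) (\<lambda>t. integral (cbox 0 (2*pi)) (\<lambda>s. K (Complex (fst w) s, Complex (snd z) t)))"
      using cont[OF w'X(1)] by (intro integral_swap_continuous) (simp add: torus_point_def w'_def split_def)
    also have "\<dots> = integral (cbox 0 (2*pi)) (\<lambda>t. integral (cbox 0 (2*pi)) (\<lambda>s. K (Complex (fst z) s, Complex (snd z) t)))"
    proof (rule integral_cong)
      fix t
      have sub: "(u, Complex (snd z) t) \<in> tube X" if "fst z - e1 < Re u" "Re u < fst z + e1" for u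
        using that mem[of "Re u" "snd z"] e2 by (auto simp: tube_def dist_real_def)
      have "(\<lambda>u. K (u, Complex (snd z) t)) holomorphic_on {u. (u, Complex (snd z) t) \<in> tube X}"
        using K unfolding periodic_holo_def by blast
      then have hol: "(\<lambda>u. K (u, Complex (snd z) t)) holomorphic_on {u. fst z - e1 < Re u \<and> Re u < fst z + e1}"
        by (rule holomorphic_on_subset) (use sub in auto)
      have per: "K (u + 2 * of_real pi * \<i>, Complex (snd z) t) = K (u, Complex (snd z) t)"
        if "fst z - e1 < Re u" "Re u < fst z + e1" for u
        using K sub[OF that] unfolding periodic_holo_def by blast
      have "fst z - e1 < fst w" "fst w < fst z + e1" "fst z - e1 < fst z" "fst z < fst z + e1"
        using w e1 by (auto simp: mem_Times_iff dist_real_def abs_less_iff)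
      from vertical_mean_const[OF hol per this]
      show "integral (cbox 0 (2*pi)) (\<lambda>s. K (Complex (fst w) s, Complex (snd z) t)) = integral (cbox 0 (2*pi)) (\<lambda>s. K (Complex (fst z) s, Complex (snd z) t))"
        by simp
    qed
    also have "\<dots> = integral (cbox 0 (2*pi)) (\<lambda>s. integral (cbox 0 (2*pi)) (\<lambda>t. K (Complex (fst z) s, Complex (snd z) t)))"
      using cont[OF z] by (intro integral_swap_continuous[symmetric]) (simp add: torus_point_def split_def)
    also have "\<dots> = torus_mean K z"
      unfolding torus_mean_def torus_box_def
      by (subst integral_prod_continuous[OF cont[OF z]]) (simp add: torus_point_def)
    finally show ?thesis .
  qed
  note const = this
  show "\<forall>\<^sub>F b in at z within X. torus_mean K z = torus_mean K b"
    unfolding eventually_at_topological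
  proof (rule exI[of _ "ball (fst z) e1 \<times> ball (snd z) e2"], intro conjI ballI impI)
    show "open (ball (fst z) e1 \<times> ball (snd z) e2)"
      by (rule open_Times) (rule open_ball)+
    show "z \<in> ball (fst z) e1 \<times> ball (snd z) e2"
      using e1(1) e2(1) by (simp only: mem_Times_iff centre_in_ball simp_thms)
  qed (rule const[symmetric])
qed

text \<open>Division by the monomial of index (m, n): the torus mean of the twist is (2 pi)^2 times
  the Laurent coefficient of \<open>K\<close> at that index.\<close>

definition laurent_twist :: "int \<Rightarrow> int \<Rightarrow> (complex \<times> complex \<Rightarrow> complex) \<Rightarrow> complex \<times> complex \<Rightarrow> complex" where
  "laurent_twist m n K w = K w * exp (- (of_int m * fst w + of_int n * snd w))"

lemma exp_int_period: "exp (w + of_int m * (2 * of_real pi * \<i>)) = exp w"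
  by (subst exp_eq) (auto intro!: exI[of _ m])

lemma periodic_holo_twist:
  assumes "periodic_holo X K"
  shows "periodic_holo X (laurent_twist m n K)"
proof -
  have *: "exp (- (of_int m * (u + 2 * of_real pi * \<i>) + of_int n * v)) = exp (- (of_int m * u + of_int n * v))"
    "exp (- (of_int m * u + of_int n * (v + 2 * of_real pi * \<i>))) = exp (- (of_int m * u + of_int n * v))" for u v :: complex
    using exp_int_period[of "- (of_int m * u + of_int n * v)" "-m"] exp_int_period[of "- (of_int m * u + of_int n * v)" "-n"]
    by (simp_all add: algebra_simps)
  show ?thesis
    using assms unfolding periodic_holo_def laurent_twist_def fst_conv snd_conv *
    by (intro conjI allI impI continuous_intros holomorphic_intros) simp_all
qed

lemma torus_char_integral:
  assumes "m \<noteq> 0 \<or> n \<noteq> 0"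
  shows "integral torus_box (torus_char m n) = 0"
proof -
  define K where "K = laurent_twist (-m) (-n) (\<lambda>_. 1)"
  have "periodic_holo UNIV (\<lambda>_. 1)"
    by (simp add: periodic_holo_def)
  then have K: "periodic_holo UNIV K"
    unfolding K_def by (rule periodic_holo_twist)
  have "K (torus_point x \<theta>) = exp (of_real (of_int m * fst x + of_int n * snd x)) * torus_char m n \<theta>" for x :: "real \<times> real" and \<theta>
    unfolding K_def laurent_twist_def torus_point_def torus_char_def
    by (simp add: Complex_eq cis_conv_exp exp_add algebra_simps)
  then have eq: "torus_mean K x = exp (of_real (of_int m * fst x + of_int n * snd x)) * integral torus_box (torus_char m n)" for x :: "real \<times> real"
    unfolding torus_mean_def by simp
  \<comment> \<open>A torus mean does not depend on the torus, but that of a monomial scales with the monomial.\<close>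
  have "torus_mean K (0,0) = torus_mean K (of_int m, of_int n)"
    by (rule torus_mean_const[OF K]) auto
  then have *: "integral torus_box (torus_char m n) = exp (of_real (of_int m * of_int m + of_int n * of_int n)) * integral torus_box (torus_char m n)"
    unfolding eq by simp
  have "(0::real) < of_int m * of_int m + of_int n * of_int n"
    using assms by (simp add: sum_squares_gt_zero_iff)
  then have "exp (of_real (of_int m * of_int m + of_int n * of_int n)) \<noteq> (1::complex)"
    by (simp only: exp_of_real of_real_eq_1_iff exp_eq_one_iff less_imp_neq[symmetric] not_False_eq_True)
  with * show ?thesis
    by (simp only: mult_cancel_right1 eq_commute[of "integral torus_box (torus_char m n)"] mult_cancel_left2) blast
qed

text \<open>Separates a Fourier coefficient on the torus over \<open>x\<close> into an explicit
  exponential in \<open>x\<close> and a mean that does not depend on \<open>x\<close> on a connected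
  region.\<close>

lemma torus_mean_twist:
  "integral torus_box (\<lambda>\<theta>. K (torus_point x \<theta>) * torus_char (-m) (-n) \<theta>) =
    exp (of_real (of_int m * fst x + of_int n * snd x)) * torus_mean (laurent_twist m n K) x"
proof -
  have "K (torus_point x \<theta>) * torus_char (-m) (-n) \<theta> =
      exp (of_real (of_int m * fst x + of_int n * snd x)) * laurent_twist m n K (torus_point x \<theta>)" for \<theta>
    unfolding laurent_twist_def torus_point_def torus_char_def
    by (simp add: Complex_eq cis_conv_exp exp_add exp_diff exp_minus field_simps)
  then show ?thesis unfolding torus_mean_def by simp
qed

text \<open>The function \<open>M - s Re \<phi>\<close> is nonnegative, so its \<open>L\<^sup>1\<close> norm is its integral.\<close>

lemma coefficient_real_part_bound:
  fixes \<phi> :: "real \<times> real \<Rightarrow> complex"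
  assumes cont: "continuous_on torus_box \<phi>" and mn: "m \<noteq> 0 \<or> n \<noteq> 0"
    and s: "\<bar>s\<bar> = 1" and bnd: "\<And>\<theta>. \<theta> \<in> torus_box \<Longrightarrow> s * Re (\<phi> \<theta>) \<le> M"
  shows "cmod (integral torus_box (\<lambda>\<theta>. of_real (Re (\<phi> \<theta>)) * torus_char m n \<theta>))
    \<le> (2*pi)\<^sup>2 * M + cmod (integral torus_box \<phi>)"
proof -
  let ?g = "\<lambda>\<theta>. of_real (M - s * Re (\<phi> \<theta>)) * torus_char m n \<theta>"
  have s2: "s * s = 1" using s by (metis abs_mult_self_eq mult_1)
  have "integral torus_box (\<lambda>\<theta>. of_real (Re (\<phi> \<theta>)) * torus_char m n \<theta>) =
        integral torus_box (\<lambda>\<theta>. of_real s * (of_real M * torus_char m n \<theta>) - of_real s * ?g \<theta>)"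
  proof (rule integral_cong)
    fix \<theta>
    have "of_real s * (of_real M * torus_char m n \<theta>) - of_real s * ?g \<theta>
      = of_real (s * s) * (of_real (Re (\<phi> \<theta>)) * torus_char m n \<theta>)"
      by (simp add: algebra_simps)
    then show "of_real (Re (\<phi> \<theta>)) * torus_char m n \<theta> = of_real s * (of_real M * torus_char m n \<theta>) - of_real s * ?g \<theta>"
      unfolding s2 by simp
  qed
  also have "\<dots> = of_real s * (of_real M * integral torus_box (torus_char m n)) - of_real s * integral torus_box ?g"
    by (subst integral_diff) (auto intro!: integrable_on_torus_box continuous_intros cont)
  also have "\<dots> = - of_real s * integral torus_box ?g"
    by (simp add: torus_char_integral[OF mn])
  also have "cmod \<dots> = cmod (integral torus_box ?g)"
    using s by (simp add: norm_mult)
  also have "\<dots> \<le> integral torus_box (\<lambda>\<theta>. M - s * Re (\<phi> \<theta>))"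
  proof (rule integral_norm_bound_integral)
    fix \<theta> assume "\<theta> \<in> torus_box"
    from bnd[OF this] show "cmod (?g \<theta>) \<le> M - s * Re (\<phi> \<theta>)"
      by (simp add: norm_mult torus_char_def del: of_real_diff)
  qed (intro integrable_on_torus_box continuous_intros cont)+
  also have "\<dots> = (2*pi)\<^sup>2 * M - s * Re (integral torus_box \<phi>)"
  proof -
    have "integral torus_box (\<lambda>\<theta>. M) = (2*pi)\<^sup>2 * M"
      unfolding torus_box_def by (simp add: content_Pair power2_eq_square)
    moreover have "integral torus_box (\<lambda>\<theta>. Re (\<phi> \<theta>)) = Re (integral torus_box \<phi>)"
      using integral_linear[OF integrable_on_torus_box[OF cont] bounded_linear_Re] by (simp add: o_def)
    ultimately show ?thesis
      by (subst integral_diff) (auto intro!: integrable_on_torus_box continuous_intros cont)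
  qed
  also have "\<dots> \<le> (2*pi)\<^sup>2 * M + cmod (integral torus_box \<phi>)"
    using abs_Re_le_cmod[of "integral torus_box \<phi>"] s by (auto simp: abs_if split: if_splits)
  finally show ?thesis .
qed

lemma exp_growth_zero:
  fixes a b c \<kappa> :: real
  assumes "\<And>r. r \<ge> 0 \<Longrightarrow> c * exp (\<kappa> * r) \<le> a + b * r" "\<kappa> > 0"
  shows "c \<le> 0"
proof -
  have "((\<lambda>r. (a + b * r) / exp (\<kappa> * r)) \<longlongrightarrow> 0) at_top"
    using \<open>\<kappa> > 0\<close> by real_asymp
  moreover have "\<forall>\<^sub>F r in at_top. c \<le> (a + b * r) / exp (\<kappa> * r)"
    using eventually_ge_at_top[of 0] by eventually_elim (use assms(1) in \<open>simp add: pos_le_divide_eq\<close>)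
  ultimately show ?thesis
    by (rule tendsto_lowerbound) simp
qed

text \<open>
  Along the ray the coefficient of \<open>Re K\<close> at \<open>(-m, -n)\<close> grows only linearly, whereas
  the contribution of the Laurent coefficient of \<open>K\<close> is multiplied by an increasing exponential
  and that of the conjugate of \<open>K\<close> by a decreasing one.
\<close>

lemma coefficient_vanishes:
  assumes K: "periodic_holo X K" and X: "open X" "connected X"
    and ray: "\<And>r. r \<ge> 0 \<Longrightarrow> (x1 + r * d1, x2 + r * d2) \<in> X"
    and s: "\<bar>s\<bar> = 1"
    and bnd: "\<And>r \<theta>. r \<ge> 0 \<Longrightarrow> s * Re (K (torus_point (x1 + r * d1, x2 + r * d2) \<theta>)) \<le> A + B * r"
    and mn: "of_int m * d1 + of_int n * d2 > 0" and x: "x \<in> X"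
  shows "torus_mean (laurent_twist m n K) x = 0"
proof -
  define P where "P r = (x1 + r * d1, x2 + r * d2)" for r
  define \<kappa> where "\<kappa> = of_int m * d1 + of_int n * d2"
  define \<nu> where "\<nu> = of_int m * x1 + of_int n * x2"
  have P: "P r \<in> X" if "r \<ge> 0" for r using ray that by (simp add: P_def)
  have mP: "of_int m * fst (P r) + of_int n * snd (P r) = \<nu> + \<kappa> * r" for r
    by (simp add: P_def \<nu>_def \<kappa>_def algebra_simps)
  define C C' C0 where "C = torus_mean (laurent_twist m n K) x"
    and "C' = torus_mean (laurent_twist (-m) (-n) K) x" and "C0 = torus_mean K x"
  have C: "torus_mean (laurent_twist m n K) y = C" "torus_mean (laurent_twist (-m) (-n) K) y = C'" "torus_mean K y = C0"
    if "y \<in> X" for y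
    using torus_mean_const[OF _ X that x] K periodic_holo_twist unfolding C_def C'_def C0_def by blast+
  have contK: "continuous_on torus_box (\<lambda>\<theta>. K (torus_point y \<theta>))" if "y \<in> X" for y
    using K that continuous_on_torus_point unfolding periodic_holo_def by blast
  \<comment> \<open>Twice the coefficient of \<open>Re K\<close> is the sum of the contributions of
    \<open>K\<close> and its conjugate. The first is isolated by the triangle inequality, and the
    decaying second one is bounded by its value at r = 0.\<close>
  have "cmod C * exp \<nu> * exp (\<kappa> * r) \<le> (2 * ((2*pi)\<^sup>2 * A + cmod C0) + exp (-\<nu>) * cmod C') + (2 * (2*pi)\<^sup>2 * B) * r"
    if r: "r \<ge> 0" for r
  proof -
    let ?K = "\<lambda>\<theta>. K (torus_point (P r) \<theta>)"
    let ?J = "integral torus_box (\<lambda>\<theta>. of_real (Re (?K \<theta>)) * torus_char (-m) (-n) \<theta>)"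
    have c: "continuous_on torus_box ?K" using contK[OF P[OF r]] .
    have tw: "integral torus_box (\<lambda>\<theta>. ?K \<theta> * torus_char (-m) (-n) \<theta>) = exp (of_real (\<nu> + \<kappa> * r)) * C"
      using torus_mean_twist[of K "P r" m n] C(1)[OF P[OF r]] mP by simp
    have tw': "integral torus_box (\<lambda>\<theta>. ?K \<theta> * torus_char m n \<theta>) = exp (of_real (- (\<nu> + \<kappa> * r))) * C'"
    proof -
      have "of_int (-m) * fst (P r) + of_int (-n) * snd (P r) = - (\<nu> + \<kappa> * r)"
        unfolding mP[symmetric] by simp
      then show ?thesis
        using torus_mean_twist[of K "P r" "-m" "-n"] by (simp only: minus_minus C(2)[OF P[OF r]])
    qed
    have "integral torus_box (\<lambda>\<theta>. cnj (?K \<theta>) * torus_char (-m) (-n) \<theta>) =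
        integral torus_box (cnj \<circ> (\<lambda>\<theta>. ?K \<theta> * torus_char m n \<theta>))"
      by (intro integral_cong) (simp add: torus_char_def cis_cnj algebra_simps)
    also have "\<dots> = cnj (integral torus_box (\<lambda>\<theta>. ?K \<theta> * torus_char m n \<theta>))"
      by (intro integral_linear integrable_on_torus_box continuous_intros c bounded_linear_cnj)
    also have "\<dots> = exp (of_real (- (\<nu> + \<kappa> * r))) * cnj C'"
      unfolding tw' by (simp only: complex_cnj_mult exp_of_real complex_cnj_complex_of_real)
    finally have twc: "integral torus_box (\<lambda>\<theta>. cnj (?K \<theta>) * torus_char (-m) (-n) \<theta>) = exp (of_real (- (\<nu> + \<kappa> * r))) * cnj C'" .
    have "2 * ?J = integral torus_box (\<lambda>\<theta>. ?K \<theta> * torus_char (-m) (-n) \<theta> + cnj (?K \<theta>) * torus_char (-m) (-n) \<theta>)"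
      by (subst integral_mult_right[symmetric], intro integral_cong) (simp add: complex_add_cnj flip: distrib_right mult.assoc)
    also have "\<dots> = exp (of_real (\<nu> + \<kappa> * r)) * C + exp (of_real (- (\<nu> + \<kappa> * r))) * cnj C'"
      unfolding tw[symmetric] twc[symmetric]
      by (intro integral_add integrable_on_torus_box continuous_intros c)
    finally have "exp (of_real (\<nu> + \<kappa> * r)) * C = 2 * ?J - exp (of_real (- (\<nu> + \<kappa> * r))) * cnj C'"
      by (simp add: algebra_simps)
    then have "cmod (exp (of_real (\<nu> + \<kappa> * r)) * C) \<le> cmod (2 * ?J) + cmod (exp (of_real (- (\<nu> + \<kappa> * r))) * cnj C')"
      by (metis norm_triangle_ineq4)
    moreover have "cmod (exp (of_real (\<nu> + \<kappa> * r)) * C) = exp (\<nu> + \<kappa> * r) * cmod C"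
      "cmod (exp (of_real (- (\<nu> + \<kappa> * r))) * cnj C') = exp (- (\<nu> + \<kappa> * r)) * cmod C'"
      "cmod (2 * ?J) = 2 * cmod ?J"
      by (simp_all only: norm_mult norm_exp_eq_Re Re_complex_of_real complex_mod_cnj norm_numeral)
    moreover have "cmod ?J \<le> (2*pi)\<^sup>2 * (A + B * r) + cmod (integral torus_box ?K)"
      by (rule coefficient_real_part_bound[OF c _ s]) (use mn bnd r in \<open>auto simp: P_def\<close>)
    moreover have "integral torus_box ?K = C0"
      using C(3)[OF P[OF r]] by (simp add: torus_mean_def)
    moreover have "exp (- (\<nu> + \<kappa> * r)) * cmod C' \<le> exp (- \<nu>) * cmod C'"
      using r mn by (intro mult_right_mono) (auto simp: \<kappa>_def)
    ultimately show ?thesis by (simp add: exp_add algebra_simps)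
  qed
  then have "cmod C * exp \<nu> \<le> 0"
    by (rule exp_growth_zero) (use mn \<kappa>_def in auto)
  then have "C = 0"
    by (simp add: mult_le_0_iff)
  then show ?thesis by (simp add: C_def)
qed

section \<open>A Liouville theorem for periodic functions on tubes\<close>

lemma periodic_holo_int_shift:
  assumes K: "periodic_holo X K" and w: "(u, v) \<in> tube X"
  shows "K (u + of_int m * (2 * of_real pi * \<i>), v + of_int n * (2 * of_real pi * \<i>)) = K (u, v)"
proof -
  have u: "K (u + of_int m * (2 * of_real pi * \<i>), v) = K (u, v)" if "(u, v) \<in> tube X" for u v m
  proof (induction m rule: int_induct[of _ 0])
    case (step1 i)
    have "(u + of_int i * (2 * of_real pi * \<i>), v) \<in> tube X" using that by (simp add: tube_def)
    then have "K (u + of_int i * (2 * of_real pi * \<i>) + 2 * of_real pi * \<i>, v) = K (u + of_int i * (2 * of_real pi * \<i>), v)"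
      using K unfolding periodic_holo_def by blast
    with step1 show ?case by (simp add: algebra_simps)
  next
    case (step2 i)
    have "(u + of_int (i - 1) * (2 * of_real pi * \<i>), v) \<in> tube X" using that by (simp add: tube_def)
    then have "K (u + of_int (i - 1) * (2 * of_real pi * \<i>) + 2 * of_real pi * \<i>, v) = K (u + of_int (i - 1) * (2 * of_real pi * \<i>), v)"
      using K unfolding periodic_holo_def by blast
    with step2 show ?case by (simp add: algebra_simps)
  qed simp
  have v: "K (u, v + of_int m * (2 * of_real pi * \<i>)) = K (u, v)" if "(u, v) \<in> tube X" for u v m
  proof (induction m rule: int_induct[of _ 0])
    case (step1 i)
    have "(u, v + of_int i * (2 * of_real pi * \<i>)) \<in> tube X" using that by (simp add: tube_def)
    then have "K (u, v + of_int i * (2 * of_real pi * \<i>) + 2 * of_real pi * \<i>) = K (u, v + of_int i * (2 * of_real pi * \<i>))"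
      using K unfolding periodic_holo_def by blast
    with step1 show ?case by (simp add: algebra_simps)
  next
    case (step2 i)
    have "(u, v + of_int (i - 1) * (2 * of_real pi * \<i>)) \<in> tube X" using that by (simp add: tube_def)
    then have "K (u, v + of_int (i - 1) * (2 * of_real pi * \<i>) + 2 * of_real pi * \<i>) = K (u, v + of_int (i - 1) * (2 * of_real pi * \<i>))"
      using K unfolding periodic_holo_def by blast
    with step2 show ?case by (simp add: algebra_simps)
  qed simp
  have "(u, v + of_int n * (2 * of_real pi * \<i>)) \<in> tube X" using w by (simp add: tube_def)
  from u[OF this] v[OF w] show ?thesis by simp
qed

lemma ex_reduced_angle: "\<exists>k::int. t - of_int k * (2*pi) \<in> {0..2*pi}"
proof (intro exI[of _ "\<lfloor>t / (2*pi)\<rfloor>"])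
  have "of_int \<lfloor>t / (2*pi)\<rfloor> * (2*pi) \<le> t" "t < (of_int \<lfloor>t / (2*pi)\<rfloor> + 1) * (2*pi)"
    by (simp_all only: floor_divide_lower floor_divide_upper pi_gt_zero zero_less_mult_iff zero_less_numeral simp_thms)
  then show "t - of_int \<lfloor>t / (2*pi)\<rfloor> * (2*pi) \<in> {0..2*pi}" by (simp add: algebra_simps)
qed

text \<open>By \<open>irr\<close>, every nonzero index pairs positively with the direction d or with
  -d, so its coefficient is killed along the first or the second ray. Only the constant coefficient
  is left, and Fourier uniqueness on each torus finishes. The signs \<open>s1\<close> and
  \<open>s2\<close> may differ.\<close>

lemma periodic_holo_liouville:
  assumes K: "periodic_holo X K" and X: "open X" "connected X"
    and ray1: "\<And>r. r \<ge> 0 \<Longrightarrow> (x1 + r * d1, x2 + r * d2) \<in> X"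
    and ray2: "\<And>r. r \<ge> 0 \<Longrightarrow> (y1 - r * d1, y2 - r * d2) \<in> X"
    and s: "\<bar>s1\<bar> = 1" "\<bar>s2\<bar> = 1"
    and bnd1: "\<And>r \<theta>. r \<ge> 0 \<Longrightarrow> s1 * Re (K (torus_point (x1 + r * d1, x2 + r * d2) \<theta>)) \<le> A1 + B1 * r"
    and bnd2: "\<And>r \<theta>. r \<ge> 0 \<Longrightarrow> s2 * Re (K (torus_point (y1 - r * d1, y2 - r * d2) \<theta>)) \<le> A2 + B2 * r"
    and irr: "\<And>m n::int. of_int m * d1 + of_int n * d2 = 0 \<Longrightarrow> m = 0 \<and> n = 0"
  obtains c where "\<And>w. w \<in> tube X \<Longrightarrow> K w = c"
proof -
  have coeff: "torus_mean (laurent_twist m n K) x = 0" if "m \<noteq> 0 \<or> n \<noteq> 0" "x \<in> X" for m n x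
  proof (cases "of_int m * d1 + of_int n * d2 > 0")
    case True
    show ?thesis by (rule coefficient_vanishes[OF K X ray1 s(1) bnd1 True that(2)])
  next
    case False
    with irr that(1) have pos: "of_int m * (- d1) + of_int n * (- d2) > 0"
      by (metis add.inverse_inverse linorder_neqE_linordered_idom minus_add_distrib mult_minus_right neg_0_less_iff_less add.commute)
    show ?thesis
    proof (rule coefficient_vanishes[OF K X _ s(2) _ pos that(2)])
      fix r :: real and \<theta> :: "real \<times> real" assume "r \<ge> 0"
      then show "(y1 + r * - d1, y2 + r * - d2) \<in> X"
        "s2 * Re (K (torus_point (y1 + r * - d1, y2 + r * - d2) \<theta>)) \<le> A2 + B2 * r"
        using ray2[of r] bnd2[of r \<theta>] by simp_all
    qed
  qed
  have x0: "(x1, x2) \<in> X" using ray1[of 0] by simp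
  define c where "c = torus_mean K (x1, x2) / (2*pi)\<^sup>2"
  have box: "K (torus_point x \<theta>) = c" if x: "x \<in> X" and \<theta>: "\<theta> \<in> torus_box" for x :: "real \<times> real" and \<theta>
  proof -
    have cont: "continuous_on torus_box (\<lambda>\<theta>. K (torus_point x \<theta>))"
      using K x continuous_on_torus_point unfolding periodic_holo_def by blast
    have "K (torus_point x \<theta>) - c = 0"
    proof (rule torus_fourier_unique[OF _ _ _ _ \<theta>])
      show "continuous_on torus_box (\<lambda>\<theta>. K (torus_point x \<theta>) - c)"
        by (intro continuous_intros cont)
    next
      fix t :: real
      have "torus_point x (2*pi, t) = (Complex (fst x) 0 + 2 * of_real pi * \<i>, Complex (snd x) t)"
        "torus_point x (t, 2*pi) = (Complex (fst x) t, Complex (snd x) 0 + 2 * of_real pi * \<i>)"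
        by (simp_all add: torus_point_def complex_eq_iff)
      moreover have "(Complex (fst x) 0, Complex (snd x) t) \<in> tube X" "(Complex (fst x) t, Complex (snd x) 0) \<in> tube X"
        using x by (simp_all add: tube_def)
      ultimately show "K (torus_point x (0, t)) - c = K (torus_point x (2*pi, t)) - c"
        "K (torus_point x (t, 0)) - c = K (torus_point x (t, 2*pi)) - c"
        using K unfolding periodic_holo_def by (simp_all add: torus_point_def)
    next
      fix m n
      have "integral torus_box (\<lambda>\<theta>. (K (torus_point x \<theta>) - c) * torus_char m n \<theta>) =
         integral torus_box (\<lambda>\<theta>. K (torus_point x \<theta>) * torus_char m n \<theta> - c * torus_char m n \<theta>)"
        by (simp add: algebra_simps)
      also have "\<dots> = integral torus_box (\<lambda>\<theta>. K (torus_point x \<theta>) * torus_char m n \<theta>) - c * integral torus_box (torus_char m n)"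
        by (subst integral_diff) (auto intro!: integrable_on_torus_box continuous_intros cont)
      also have "\<dots> = 0"
      proof (cases "m = 0 \<and> n = 0")
        case True
        have one: "torus_char 0 0 = (\<lambda>_. 1)"
          by (simp add: torus_char_def fun_eq_iff)
        have "integral torus_box (\<lambda>_. 1::complex) = of_real ((2*pi)\<^sup>2)"
          unfolding torus_box_def by (simp add: content_Pair power2_eq_square scaleR_conv_of_real)
        moreover have "integral torus_box (\<lambda>\<theta>. K (torus_point x \<theta>)) = torus_mean K (x1, x2)"
          using torus_mean_const[OF K X x x0] by (simp add: torus_mean_def)
        ultimately show ?thesis using True by (simp add: one c_def)
      next
        case False
        then show ?thesis
          using torus_mean_twist[of K x "-m" "-n"] coeff[of "-m" "-n"] x torus_char_integral[of m n] by simp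
      qed
      finally show "integral torus_box (\<lambda>\<theta>. (K (torus_point x \<theta>) - c) * torus_char m n \<theta>) = 0" .
    qed
    then show ?thesis by simp
  qed
  show thesis
  proof (rule that[of c])
    fix w assume w: "w \<in> tube X"
    \<comment> \<open>Both imaginary parts are reduced to the fundamental square, where
      \<open>box\<close> applies.\<close>
    obtain k l :: int where kl: "Im (fst w) - of_int k * (2*pi) \<in> {0..2*pi}" "Im (snd w) - of_int l * (2*pi) \<in> {0..2*pi}"
      using ex_reduced_angle by metis
    let ?\<theta> = "(Im (fst w) - of_int k * (2*pi), Im (snd w) - of_int l * (2*pi))"
    let ?x = "(Re (fst w), Re (snd w))"
    have x: "?x \<in> X" using w by (simp add: tube_def)
    have "K (torus_point ?x ?\<theta>) = c"
      using kl x by (intro box) (auto simp: mem_torus_box)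
    moreover have "torus_point ?x ?\<theta> = (fst w + of_int (-k) * (2 * of_real pi * \<i>), snd w + of_int (-l) * (2 * of_real pi * \<i>))"
      by (simp add: torus_point_def complex_eq_iff)
    ultimately show "K w = c"
      using periodic_holo_int_shift[OF K, of "fst w" "snd w" "-k" "-l"] w by simp
  qed
qed

section \<open>Logarithms and the exponential map\<close>

text \<open>Near \<open>z\<close> the function \<open>g\<close> is
  \<open>g z + Ln (f w / f z)\<close>: continuity keeps \<open>g w - g z\<close> within distance pi
  of 0, where the principal logarithm inverts \<open>exp\<close>.\<close>

lemma continuous_log_holomorphic:
  assumes S: "open S" and f: "f holomorphic_on S" and g: "continuous_on S g"
    and fg: "\<And>z. z \<in> S \<Longrightarrow> f z = exp (g z)"
  shows "g holomorphic_on S"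
  unfolding holomorphic_on_open[OF S]
proof
  fix z assume z: "z \<in> S"
  obtain f' where f': "(f has_field_derivative f') (at z)"
    using f z holomorphic_on_open[OF S] by blast
  have "isCont g z" using g S z continuous_on_eq_continuous_at by blast
  then obtain e1 where e1: "e1 > 0" "\<And>w. dist w z < e1 \<Longrightarrow> dist (g w) (g z) < pi"
    unfolding continuous_at_eps_delta using pi_gt_zero by metis
  obtain e2 where e2: "e2 > 0" "ball z e2 \<subseteq> S"
    using S z openE by blast
  have "((\<lambda>w. g z + Ln (f w / f z)) has_field_derivative f' / f z) (at z)"
    using fg[OF z] by (auto intro!: derivative_eq_intros f')
  moreover have "g z + Ln (f w / f z) = g w" if "dist w z < min e1 e2" for w
  proof -
    have "w \<in> S" using e2 that by (auto simp: dist_commute)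
    then have "f w / f z = exp (g w - g z)"
      by (simp only: fg z exp_diff)
    moreover have "cmod (g w - g z) < pi"
      using e1(2)[of w] that by (simp add: dist_norm)
    then have "- pi < Im (g w - g z)" "Im (g w - g z) \<le> pi"
      using abs_Im_le_cmod[of "g w - g z"] by linarith+
    then have "Ln (exp (g w - g z)) = g w - g z" by (rule Ln_exp)
    ultimately show ?thesis by (simp only: add_diff_eq add_diff_cancel_left')
  qed
  ultimately have "(g has_field_derivative f' / f z) (at z)"
    using e1(1) e2(1) by (elim has_field_derivative_transform_within[of _ _ _ _ "min e1 e2"]) auto
  then show "\<exists>g'. (g has_field_derivative g') (at z)" by blast
qed

lemma open_tube:
  assumes "open X"
  shows "open (tube X)"
proof -
  have "tube X = (\<lambda>w. (Re (fst w), Re (snd w))) -` X" by (auto simp: tube_def)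
  then show ?thesis
    by (simp only:) (intro open_vimage assms continuous_intros)
qed

lemma open_tube_sections:
  assumes "open X"
  shows "open {u. (u, v) \<in> tube X}" "open {u. (v, u) \<in> tube X}"
proof -
  have "{u. (u, v) \<in> tube X} = (\<lambda>u. (u, v)) -` tube X" "{u. (v, u) \<in> tube X} = (\<lambda>u. (v, u)) -` tube X" by auto
  then show "open {u. (u, v) \<in> tube X}" "open {u. (v, u) \<in> tube X}"
    by (simp_all only:) (intro open_vimage open_tube assms continuous_intros)+
qed

text \<open>Starlikeness yields the contractibility needed for continuous logarithms, and
  connectedness.\<close>

lemma starlike_tube:
  assumes a: "a \<in> X" "\<And>x. x \<in> X \<Longrightarrow> closed_segment a x \<subseteq> X"
  shows "starlike (tube X)"
  unfolding starlike_def
proof (intro bexI ballI)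
  let ?a = "(of_real (fst a), of_real (snd a)) :: complex \<times> complex"
  show "?a \<in> tube X" using a by (simp add: tube_def)
  fix w assume "w \<in> tube X"
  then have "closed_segment a (Re (fst w), Re (snd w)) \<subseteq> X"
    using a by (simp add: tube_def)
  then have seg: "(1 - t) *\<^sub>R a + t *\<^sub>R (Re (fst w), Re (snd w)) \<in> X" if "0 \<le> t" "t \<le> 1" for t
    using that unfolding closed_segment_def by blast
  show "closed_segment ?a w \<subseteq> tube X"
  proof
    fix z assume "z \<in> closed_segment ?a w"
    then obtain t where t: "0 \<le> t" "t \<le> 1" and z: "z = (1 - t) *\<^sub>R ?a + t *\<^sub>R w"
      unfolding closed_segment_def by blast
    have "(Re (fst z), Re (snd z)) = (1 - t) *\<^sub>R a + t *\<^sub>R (Re (fst w), Re (snd w))"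
      unfolding z by (simp add: prod_eq_iff)
    with seg[OF t] show "z \<in> tube X"
      unfolding tube_def by simp
  qed
qed

text \<open>The values lie in the discrete group of integer multiples of 2 pi i, so a continuous
  function on a connected set cannot move between them.\<close>

lemma exp_eq_1_shift_const:
  fixes h :: "'a::topological_space \<Rightarrow> complex"
  assumes S: "connected S" and h: "continuous_on S h" and "\<And>x. x \<in> S \<Longrightarrow> exp (h x) = 1"
  obtains n :: int where "\<And>x. x \<in> S \<Longrightarrow> h x = of_int n * (2 * of_real pi * \<i>)"
proof -
  have *: "\<exists>n::int. h x = of_int n * (2 * of_real pi * \<i>)" if "x \<in> S" for x
    using assms(3)[OF that] unfolding exp_eq_1 by (auto simp: complex_eq_iff mult_ac)
  have "h constant_on S"
  proof (rule continuous_discrete_range_constant[OF S h])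
    fix x assume x: "x \<in> S"
    obtain m :: int where m: "h x = of_int m * (2 * of_real pi * \<i>)" using *[OF x] by blast
    have "1 \<le> cmod (h y - h x)" if y: "y \<in> S" "h y \<noteq> h x" for y
    proof -
      obtain n :: int where n: "h y = of_int n * (2 * of_real pi * \<i>)" using *[OF y(1)] by blast
      then have "n \<noteq> m" using m y(2) by auto
      have "h y - h x = of_int (n - m) * (2 * of_real pi * \<i>)"
        unfolding m n by (simp add: algebra_simps)
      then have "cmod (h y - h x) = \<bar>of_int (n - m)\<bar> * (2 * pi)"
        by (simp add: norm_mult del: of_int_diff)
      moreover have "1 \<le> \<bar>real_of_int (n - m)\<bar>" using \<open>n \<noteq> m\<close> by linarith
      moreover have "1 \<le> 2 * pi" using pi_gt3 by linarith
      ultimately show ?thesis using mult_mono[of 1 "\<bar>real_of_int (n - m)\<bar>" 1 "2*pi"] by linarith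
    qed
    then show "\<exists>e>0. \<forall>y. y \<in> S \<and> h y \<noteq> h x \<longrightarrow> e \<le> cmod (h y - h x)"
      by (intro exI[of _ 1]) auto
  qed
  then obtain c where c: "\<And>x. x \<in> S \<Longrightarrow> h x = c" unfolding constant_on_def by blast
  show thesis
  proof (cases "S = {}")
    case False
    then show thesis using * c that by (metis ex_in_conv)
  qed (use that in auto)
qed

text \<open>A continuous logarithm changes along each period by a constant multiple of 2 pi i. The
  integers \<open>m\<close> and \<open>n\<close> are the winding numbers of \<open>f\<close> along
  the two coordinate circles; subtracting the corresponding linear form leaves a periodic
  remainder.\<close>

lemma periodic_holo_log:
  assumes f: "periodic_holo X f" and X: "open X"
    and a: "a \<in> X" "\<And>x. x \<in> X \<Longrightarrow> closed_segment a x \<subseteq> X"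
    and nz: "\<And>w. w \<in> tube X \<Longrightarrow> f w \<noteq> 0"
  obtains P and m n :: int where "periodic_holo X P"
    "\<And>w. w \<in> tube X \<Longrightarrow> f w = exp (of_int m * fst w + of_int n * snd w + P w)"
proof -
  note star = starlike_tube[OF a]
  have contf: "continuous_on (tube X) f" using f by (simp add: periodic_holo_def)
  obtain g where g: "continuous_on (tube X) g" "\<And>w. w \<in> tube X \<Longrightarrow> f w = exp (g w)"
    using continuous_logarithm_on_contractible[OF contf starlike_imp_contractible[OF star] nz] by blast
  have shift: "(u + 2 * of_real pi * \<i>, v) \<in> tube X" "(u, v + 2 * of_real pi * \<i>) \<in> tube X"
    if "(u, v) \<in> tube X" for u v using that by (simp_all add: tube_def)
  have conn: "connected (tube X)" using star by (rule starlike_imp_connected)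
  have "\<exists>m::int. \<forall>w \<in> tube X. g (fst w + 2 * of_real pi * \<i>, snd w) - g w = of_int m * (2 * of_real pi * \<i>)"
  proof (rule exp_eq_1_shift_const[OF conn])
    show "continuous_on (tube X) (\<lambda>w. g (fst w + 2 * of_real pi * \<i>, snd w) - g w)"
      by (intro continuous_on_diff g continuous_on_compose2[OF g(1)] continuous_on_Pair continuous_on_add
          continuous_on_fst continuous_on_snd continuous_on_id continuous_on_const) (use shift in auto)
    fix w assume w: "w \<in> tube X"
    then have "f (fst w + 2 * of_real pi * \<i>, snd w) = f w"
      using f unfolding periodic_holo_def by (metis prod.collapse)
    then have "exp (g (fst w + 2 * of_real pi * \<i>, snd w)) = exp (g w)"
      using g(2) w shift by (metis prod.collapse)
    then show "exp (g (fst w + 2 * of_real pi * \<i>, snd w) - g w) = 1"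
      by (simp add: exp_diff)
  qed blast
  then obtain m :: int where m: "\<And>w. w \<in> tube X \<Longrightarrow> g (fst w + 2 * of_real pi * \<i>, snd w) - g w = of_int m * (2 * of_real pi * \<i>)"
    by blast
  have "\<exists>n::int. \<forall>w \<in> tube X. g (fst w, snd w + 2 * of_real pi * \<i>) - g w = of_int n * (2 * of_real pi * \<i>)"
  proof (rule exp_eq_1_shift_const[OF conn])
    show "continuous_on (tube X) (\<lambda>w. g (fst w, snd w + 2 * of_real pi * \<i>) - g w)"
      by (intro continuous_on_diff g continuous_on_compose2[OF g(1)] continuous_on_Pair continuous_on_add
          continuous_on_fst continuous_on_snd continuous_on_id continuous_on_const) (use shift in auto)
    fix w assume w: "w \<in> tube X"
    then have "f (fst w, snd w + 2 * of_real pi * \<i>) = f w"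
      using f unfolding periodic_holo_def by (metis prod.collapse)
    then have "exp (g (fst w, snd w + 2 * of_real pi * \<i>)) = exp (g w)"
      using g(2) w shift by (metis prod.collapse)
    then show "exp (g (fst w, snd w + 2 * of_real pi * \<i>) - g w) = 1"
      by (simp add: exp_diff)
  qed blast
  then obtain n :: int where n: "\<And>w. w \<in> tube X \<Longrightarrow> g (fst w, snd w + 2 * of_real pi * \<i>) - g w = of_int n * (2 * of_real pi * \<i>)"
    by blast
  have hol: "(\<lambda>u. g (u, v)) holomorphic_on {u. (u, v) \<in> tube X}" "(\<lambda>u. g (v, u)) holomorphic_on {u. (v, u) \<in> tube X}" for v
  proof -
    have "continuous_on {u. (u, v) \<in> tube X} (\<lambda>u. g (u, v))" "continuous_on {u. (v, u) \<in> tube X} (\<lambda>u. g (v, u))"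
      by (rule continuous_on_compose2[OF g(1)], intro continuous_intros, force)+
    moreover have "(\<lambda>u. f (u, v)) holomorphic_on {u. (u, v) \<in> tube X}" "(\<lambda>u. f (v, u)) holomorphic_on {u. (v, u) \<in> tube X}"
      using f unfolding periodic_holo_def by blast+
    ultimately show "(\<lambda>u. g (u, v)) holomorphic_on {u. (u, v) \<in> tube X}" "(\<lambda>u. g (v, u)) holomorphic_on {u. (v, u) \<in> tube X}"
      using continuous_log_holomorphic[OF open_tube_sections(1)[OF X]] continuous_log_holomorphic[OF open_tube_sections(2)[OF X]] g(2) by simp_all
  qed
  define P where "P w = g w - (of_int m * fst w + of_int n * snd w)" for w
  show thesis
  proof (rule that)
    show "periodic_holo X P"
      unfolding periodic_holo_def
    proof (intro conjI allI impI)
      show "continuous_on (tube X) P"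
        unfolding P_def by (intro continuous_intros g)
      show "(\<lambda>u. P (u, v)) holomorphic_on {u. (u, v) \<in> tube X}" "(\<lambda>u. P (v, u)) holomorphic_on {u. (v, u) \<in> tube X}" for v
        unfolding P_def fst_conv snd_conv by (intro holomorphic_intros hol)+
      fix u v assume "(u, v) \<in> tube X"
      from m[OF this] n[OF this]
      show "P (u + 2 * of_real pi * \<i>, v) = P (u, v)" "P (u, v + 2 * of_real pi * \<i>) = P (u, v)"
        by (simp_all add: P_def algebra_simps)
    qed
    show "f w = exp (of_int m * fst w + of_int n * snd w + P w)" if "w \<in> tube X" for w
      using g(2)[OF that] by (simp add: P_def)
  qed
qed

text \<open>The bridge to one-variable theory: along a complex line the matrix derivative is
  multiplication by the number \<open>(A *v w) $ j\<close>.\<close>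

lemma holomorphic_map_on_line:
  fixes f :: "complex ^ 'n \<Rightarrow> complex ^ 'm"
  assumes f: "holomorphic_map_on f D" and D: "open D"
  shows "(\<lambda>\<zeta>. f (a + \<zeta> *s w) $ j) holomorphic_on {\<zeta>. a + \<zeta> *s w \<in> D}"
proof (rule holomorphic_onI)
  fix \<zeta> assume "\<zeta> \<in> {\<zeta>. a + \<zeta> *s w \<in> D}"
  then have \<zeta>: "a + \<zeta> *s w \<in> D" by simp
  obtain A :: "complex ^ 'n ^ 'm" where "(f has_derivative (\<lambda>h. A *v h)) (at (a + \<zeta> *s w) within D)"
    using f \<zeta> unfolding holomorphic_map_on_def by blast
  then have A: "(f has_derivative (\<lambda>h. A *v h)) (at (a + \<zeta> *s w))"
    using at_within_open[OF \<zeta> D] by simp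
  have lin: "bounded_linear (\<lambda>h. h *s w)"
    unfolding linear_conv_bounded_linear[symmetric]
    by (rule linearI) (simp_all add: vec_eq_iff algebra_simps)
  have "((\<lambda>\<zeta>. a + \<zeta> *s w) has_derivative (\<lambda>h. 0 + h *s w)) (at \<zeta>)"
    by (intro has_derivative_add has_derivative_const bounded_linear.has_derivative[OF lin] has_derivative_ident)
  from has_derivative_compose[OF this A]
  have "((\<lambda>\<zeta>. f (a + \<zeta> *s w)) has_derivative (\<lambda>h. A *v (h *s w))) (at \<zeta>)"
    by simp
  then have "((\<lambda>\<zeta>. f (a + \<zeta> *s w) $ j) has_derivative (\<lambda>h. (A *v (h *s w)) $ j)) (at \<zeta>)"
    by (rule bounded_linear.has_derivative[OF bounded_linear_vec_nth])
  moreover have "(\<lambda>h. (A *v (h *s w)) $ j) = (*) ((A *v w) $ j)"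
    by (simp add: fun_eq_iff matrix_vector_mult_def sum_distrib_left mult_ac)
  ultimately have "((\<lambda>\<zeta>. f (a + \<zeta> *s w) $ j) has_field_derivative (A *v w) $ j) (at \<zeta>)"
    by (simp add: has_field_derivative_def)
  then show "(\<lambda>\<zeta>. f (a + \<zeta> *s w) $ j) field_differentiable at \<zeta> within {\<zeta>. a + \<zeta> *s w \<in> D}"
    using field_differentiable_def field_differentiable_at_within by blast
qed

lemma holomorphic_map_on_imp_continuous_on:
  "holomorphic_map_on f D \<Longrightarrow> continuous_on D f"
  unfolding holomorphic_map_on_def continuous_on_eq_continuous_within
  using has_derivative_continuous by blast

text \<open>Written with axis vectors so that freezing one argument displays a point of an affine
  complex line, the form that \<open>holomorphic_map_on_line\<close> expects.\<close>

definition exp_map :: "complex \<times> complex \<Rightarrow> complex ^ 2" where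
  "exp_map w = exp (fst w) *s axis 1 1 + exp (snd w) *s axis 2 1"

lemma exp_map_nth [simp]: "exp_map w $ 1 = exp (fst w)" "exp_map w $ 2 = exp (snd w)"
  by (simp_all add: exp_map_def axis_def)

lemma continuous_on_exp_map: "continuous_on A exp_map"
proof -
  have "bounded_linear (\<lambda>h::complex. h *s (v :: complex ^ 2))" for v
    unfolding linear_conv_bounded_linear[symmetric]
    by (rule linearI) (simp_all add: vec_eq_iff algebra_simps)
  then have "continuous_on A (\<lambda>w. g w *s v)" if "continuous_on A g" for g :: "complex \<times> complex \<Rightarrow> complex" and v :: "complex ^ 2"
    using that by (rule bounded_linear.continuous_on)
  then show ?thesis
    unfolding exp_map_def
    by (intro continuous_on_add) (simp_all add: continuous_on_exp continuous_on_fst continuous_on_snd)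
qed

lemma periodic_holo_compose_exp_map:
  fixes f :: "complex ^ 2 \<Rightarrow> complex ^ 'm"
  assumes f: "holomorphic_map_on f D" and D: "open D" "exp_map ` tube X \<subseteq> D"
  shows "periodic_holo X (\<lambda>w. f (exp_map w) $ j)"
  unfolding periodic_holo_def
proof (intro conjI allI impI)
  show "continuous_on (tube X) (\<lambda>w. f (exp_map w) $ j)"
    by (intro continuous_on_component continuous_on_compose2[OF holomorphic_map_on_imp_continuous_on[OF f]]
        continuous_on_exp_map D)
next
  fix v
  let ?a = "exp v *s axis 2 1 :: complex ^ 2"
  have eq: "exp_map (u, v) = ?a + exp u *s axis 1 1" for u
    by (simp add: exp_map_def add.commute)
  have "(\<lambda>\<zeta>. f (?a + \<zeta> *s axis 1 1) $ j) \<circ> exp holomorphic_on {u. (u, v) \<in> tube X}"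
    by (rule holomorphic_on_compose_gen[OF _ holomorphic_map_on_line[OF f D(1)]])
      (use D(2) in \<open>auto simp: eq[symmetric] intro!: holomorphic_intros\<close>)
  then show "(\<lambda>u. f (exp_map (u, v)) $ j) holomorphic_on {u. (u, v) \<in> tube X}"
    by (simp add: eq o_def)
next
  fix u
  let ?a = "exp u *s axis 1 1 :: complex ^ 2"
  have eq: "exp_map (u, v) = ?a + exp v *s axis 2 1" for v
    by (simp add: exp_map_def)
  have "(\<lambda>\<zeta>. f (?a + \<zeta> *s axis 2 1) $ j) \<circ> exp holomorphic_on {v. (u, v) \<in> tube X}"
    by (rule holomorphic_on_compose_gen[OF _ holomorphic_map_on_line[OF f D(1)]])
      (use D(2) in \<open>auto simp: eq[symmetric] intro!: holomorphic_intros\<close>)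
  then show "(\<lambda>v. f (exp_map (u, v)) $ j) holomorphic_on {v. (u, v) \<in> tube X}"
    by (simp add: eq o_def)
next
  fix u v
  show "f (exp_map (u + 2 * of_real pi * \<i>, v)) $ j = f (exp_map (u, v)) $ j"
    "f (exp_map (u, v + 2 * of_real pi * \<i>)) $ j = f (exp_map (u, v)) $ j"
    by (simp_all add: exp_map_def exp_add exp_two_pi_i)
qed

section \<open>The domains\<close>

text \<open>Linear independence of 1, \<alpha> and its square over the rationals; the case a = 0
  contains irrationality.\<close>

definition non_quadratic :: "real \<Rightarrow> bool" where
  "non_quadratic \<alpha> \<longleftrightarrow> (\<forall>a b c :: int. of_int a * \<alpha>\<^sup>2 + of_int b * \<alpha> + of_int c = 0 \<longrightarrow> a = 0 \<and> b = 0 \<and> c = 0)"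

text \<open>The disjunctions encode three kinds of leaves: y < 1 for t < p, y > 0 for t > p, and at
  t = p both, which leaves the window 0 < y < 1 joining the two arms.\<close>

definition Z_shape :: "real \<Rightarrow> (real \<times> real) set" where
  "Z_shape p = {(t, y). 0 < t \<and> t < 1 \<and> (t < p \<or> 0 < y) \<and> (p < t \<or> y < 1)}"

definition log_region :: "real \<Rightarrow> real \<Rightarrow> (real \<times> real) set" where
  "log_region \<alpha> p = {(x, y). (x + \<alpha> * y, y) \<in> Z_shape p}"

definition reinhardt_domain :: "real \<Rightarrow> real \<Rightarrow> (complex ^ 2) set" where
  "reinhardt_domain \<alpha> p = exp_map ` tube (log_region \<alpha> p)"

text \<open>Countably many integer polynomials have countably many roots, which cannot exhaust an
  interval.\<close>

lemma ex_non_quadratic: "\<exists>\<alpha>>0. non_quadratic \<alpha>"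
proof -
  define R where "R = (\<Union>(a, b, c) \<in> UNIV - {(0 :: int, 0 :: int, 0 :: int)}.
     {x :: real. poly [:of_int c, of_int b, of_int a:] x = 0})"
  have "countable R"
    unfolding R_def
  proof (rule countable_UN)
    fix abc assume nz: "abc \<in> UNIV - {(0 :: int, 0 :: int, 0 :: int)}"
    obtain a b c where abc: "abc = (a, b, c)" by (cases abc)
    have "[:of_int c, of_int b, of_int a:] \<noteq> (0 :: real poly)"
      using nz by (auto simp: abc)
    from poly_roots_finite[OF this]
    show "countable (case abc of (a, b, c) \<Rightarrow> {x :: real. poly [:of_int c, of_int b, of_int a:] x = 0})"
      unfolding abc prod.case by (rule countable_finite)
  qed simp
  moreover have "uncountable {0<..<(1::real)}"
    by (simp add: uncountable_open_interval)
  ultimately obtain \<alpha> where \<alpha>: "\<alpha> \<in> {0<..<1}" "\<alpha> \<notin> R"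
    by (metis countable_subset subsetI)
  have "non_quadratic \<alpha>"
    unfolding non_quadratic_def
  proof (intro allI impI)
    fix a b c :: int assume "of_int a * \<alpha>\<^sup>2 + of_int b * \<alpha> + of_int c = 0"
    then have "poly [:of_int c, of_int b, of_int a:] \<alpha> = 0"
      by (simp add: algebra_simps power2_eq_square)
    with \<alpha>(2) show "a = 0 \<and> b = 0 \<and> c = 0"
      unfolding R_def by blast
  qed
  with \<alpha>(1) show ?thesis by auto
qed

section \<open>Topology and symmetry of the domains\<close>

lemma open_Z_shape: "open (Z_shape p)"
proof -
  have "Z_shape p = {z. 0 < fst z} \<inter> {z. fst z < 1} \<inter> ({z. fst z < p} \<union> {z. 0 < snd z}) \<inter> ({z. p < fst z} \<union> {z. snd z < 1})"
    by (auto simp: Z_shape_def)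
  also have "open \<dots>"
    by (intro open_Int open_Un open_Collect_less continuous_intros)
  finally show ?thesis .
qed

lemma open_log_region: "open (log_region \<alpha> p)"
proof -
  have "log_region \<alpha> p = (\<lambda>z. (fst z + \<alpha> * snd z, snd z)) -` Z_shape p"
    by (auto simp: log_region_def)
  then show ?thesis
    by (simp only:) (intro open_vimage open_Z_shape continuous_intros)
qed

text \<open>The Z is starlike about the midpoint (p, 1/2) of its window: contracting towards it
  keeps the side of t = p and preserves each of the bounds 0 < y and y < 1.\<close>

lemma Z_shape_centre:
  assumes "0 < p" "p < 1" "(t, y) \<in> Z_shape p" "0 \<le> r" "r \<le> 1"
  shows "((1 - r) * p + r * t, (1 - r) * (1/2) + r * y) \<in> Z_shape p"
\<comment> \<open>At the centre itself t < p and p < t are lost, but there both bounds on y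
  hold.\<close>
proof (cases "r = 0")
  case True
  then show ?thesis using assms by (simp add: Z_shape_def)
next
  case False
  then have r: "0 < r" "r \<le> 1" using assms by auto
  have t: "0 < t" "t < 1" and ty: "t < p \<or> 0 < y" "p < t \<or> y < 1" using assms by (auto simp: Z_shape_def)
  have eq: "(1 - r) * p + r * t = p + r * (t - p)" "(1 - r) * (1/2) + r * y = 1/2 + r * (y - 1/2)"
    by (simp_all add: field_simps)
  have "0 < (1 - r) * p + r * t"
    using r t assms by (intro add_nonneg_pos mult_nonneg_nonneg mult_pos_pos) auto
  moreover have "0 < (1 - r) * (1 - p) + r * (1 - t)"
    using r t assms by (intro add_nonneg_pos mult_nonneg_nonneg mult_pos_pos) auto
  then have "(1 - r) * p + r * t < 1"
    by (simp add: algebra_simps)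
  moreover have "(1 - r) * p + r * t < p" if "t < p"
    unfolding eq using r that by (simp add: mult_pos_neg)
  moreover have "(1 - r) * p + r * t > p" if "t > p"
    unfolding eq using r that by simp
  moreover have "0 < (1 - r) * (1/2) + r * y" if "0 < y"
    using r that by (intro add_nonneg_pos mult_nonneg_nonneg mult_pos_pos) auto
  moreover have "(1 - r) * (1/2) + r * y < 1" if "y < 1"
  proof -
    have "0 < (1 - r) * (1/2) + r * (1 - y)"
      using r that by (intro add_nonneg_pos mult_nonneg_nonneg mult_pos_pos) auto
    then show ?thesis by (simp add: field_simps)
  qed
  ultimately show ?thesis using ty by (auto simp: Z_shape_def)
qed

lemma log_region_starlike:
  assumes "0 < p" "p < 1"
  shows "(p - \<alpha> * (1/2), 1/2) \<in> log_region \<alpha> p"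
    and "x \<in> log_region \<alpha> p \<Longrightarrow> closed_segment (p - \<alpha> * (1/2), 1/2) x \<subseteq> log_region \<alpha> p"
proof -
  show "(p - \<alpha> * (1/2), 1/2) \<in> log_region \<alpha> p"
    using assms by (simp add: log_region_def Z_shape_def)
  assume x: "x \<in> log_region \<alpha> p"
  show "closed_segment (p - \<alpha> * (1/2), 1/2) x \<subseteq> log_region \<alpha> p"
  proof
    fix z assume "z \<in> closed_segment (p - \<alpha> * (1/2), 1/2) x"
    then obtain r where r: "0 \<le> r" "r \<le> 1" and z: "z = (1 - r) *\<^sub>R (p - \<alpha> * (1/2), 1/2) + r *\<^sub>R x"
      unfolding closed_segment_def by blast
    obtain a b where ab: "x = (a, b)" by (cases x)
    have "((1 - r) * p + r * (a + \<alpha> * b), (1 - r) * (1/2) + r * b) \<in> Z_shape p"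
      using x r assms by (intro Z_shape_centre) (auto simp: ab log_region_def)
    moreover have "(fst z + \<alpha> * snd z, snd z) = ((1 - r) * p + r * (a + \<alpha> * b), (1 - r) * (1/2) + r * b)"
      by (simp add: z ab algebra_simps)
    ultimately show "z \<in> log_region \<alpha> p"
      by (cases z) (simp add: log_region_def)
  qed
qed

lemma connected_log_region:
  assumes "0 < p" "p < 1"
  shows "connected (log_region \<alpha> p)"
proof (rule starlike_imp_connected)
  show "starlike (log_region \<alpha> p)"
    unfolding starlike_def
    by (rule bexI[OF _ log_region_starlike(1)[OF assms]], rule ballI, rule log_region_starlike(2)[OF assms])
qed

lemma mem_reinhardt_domain:
  "z \<in> reinhardt_domain \<alpha> p \<longleftrightarrow> z $ 1 \<noteq> 0 \<and> z $ 2 \<noteq> 0 \<and> (ln (cmod (z $ 1)), ln (cmod (z $ 2))) \<in> log_region \<alpha> p"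
proof safe
  assume nz: "z $ 1 \<noteq> 0" "z $ 2 \<noteq> 0" and "(ln (cmod (z $ 1)), ln (cmod (z $ 2))) \<in> log_region \<alpha> p"
  then have "(Ln (z $ 1), Ln (z $ 2)) \<in> tube (log_region \<alpha> p)"
    by (simp add: tube_def)
  moreover have "z = exp_map (Ln (z $ 1), Ln (z $ 2))"
    using nz by (simp add: vec_eq_iff forall_2)
  ultimately show "z \<in> reinhardt_domain \<alpha> p"
    unfolding reinhardt_domain_def by blast
qed (auto simp: reinhardt_domain_def tube_def)

lemma open_reinhardt_domain: "open (reinhardt_domain \<alpha> p)"
proof -
  let ?N = "{z :: complex ^ 2. z $ 1 \<noteq> 0} \<inter> {z. z $ 2 \<noteq> 0}"
  have N: "open ?N"
    by (intro open_Int open_Collect_neq continuous_intros)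
  have "reinhardt_domain \<alpha> p = ?N \<inter> (\<lambda>z. (ln (cmod (z $ 1)), ln (cmod (z $ 2)))) -` log_region \<alpha> p"
    by (auto simp: mem_reinhardt_domain)
  moreover have "continuous_on ?N (\<lambda>z. (ln (cmod (z $ 1)), ln (cmod (z $ 2))))"
    by (intro continuous_intros) auto
  from continuous_open_preimage[OF this N open_log_region]
  have "open (?N \<inter> (\<lambda>z. (ln (cmod (z $ 1)), ln (cmod (z $ 2)))) -` log_region \<alpha> p)" .
  ultimately show ?thesis by simp
qed

lemma domain_reinhardt_domain:
  assumes "0 < p" "p < 1"
  shows "domain_in_Cn (reinhardt_domain \<alpha> p)"
proof -
  note star = starlike_tube[OF log_region_starlike(1)[OF assms, of \<alpha>] log_region_starlike(2)[OF assms]]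
  have "connected (reinhardt_domain \<alpha> p)"
    unfolding reinhardt_domain_def
    by (intro connected_continuous_image continuous_on_exp_map starlike_imp_connected star)
  moreover have "tube (log_region \<alpha> p) \<noteq> {}"
    using star by (auto simp: starlike_def)
  ultimately show ?thesis
    unfolding domain_in_Cn_def using open_reinhardt_domain by (auto simp: reinhardt_domain_def)
qed

lemma Reinhardt_reinhardt_domain: "Reinhardt (reinhardt_domain \<alpha> p)"
  unfolding Reinhardt_def
  by (auto simp: mem_reinhardt_domain rotation_def unit_torus_def norm_mult forall_2)

section \<open>Affine maps between Z-shapes\<close>

lemma affine_pos_endpoints:
  fixes k c :: real
  assumes "\<And>t. 0 < t \<Longrightarrow> t < 1 \<Longrightarrow> 0 < k * t + c"
  shows "0 \<le> c" "0 \<le> k + c"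
proof -
  have "((\<lambda>t. k * t + c) \<longlongrightarrow> k * 0 + c) (at_right 0)" "((\<lambda>t. k * t + c) \<longlongrightarrow> k * 1 + c) (at_left 1)"
    by (intro tendsto_intros)+
  moreover have "\<forall>\<^sub>F t in at_right 0. 0 \<le> k * t + c"
    unfolding eventually_at_right_field by (intro exI[of _ 1] conjI allI impI less_imp_le assms zero_less_one)
  moreover have "\<forall>\<^sub>F t in at_left 1. 0 \<le> k * t + c"
    unfolding eventually_at_left_field by (intro exI[of _ 0] conjI allI impI less_imp_le assms zero_less_one)
  ultimately show "0 \<le> c" "0 \<le> k + c"
    using tendsto_lowerbound[of "\<lambda>t. k * t + c" "k * 0 + c" "at_right 0" 0]
      tendsto_lowerbound[of "\<lambda>t. k * t + c" "k * 1 + c" "at_left 1" 0] by simp_all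
qed

text \<open>Mapping the strip 0 < t < 1 into itself limits \<open>k\<close> to -1, 0, 1. The
  unbounded arms exclude k = -1 and, for k = 1, any shift of the corner; the window then fixes
  \<open>d\<close>.\<close>

lemma Z_shape_affine:
  fixes k :: int and c d p q :: real
  assumes p: "0 < p" "p < 1/2" and q: "0 < q" "q < 1/2"
    and map: "\<And>t y. (t, y) \<in> Z_shape p \<Longrightarrow> (of_int k * t + c, of_int k * y + d) \<in> Z_shape q"
  shows "k = 0 \<or> (k = 1 \<and> p = q \<and> c = 0 \<and> d = 0)"
proof -
  \<comment> \<open>The height 1/2 lies in the Z over every t of the strip.\<close>
  have t: "0 < of_int k * t + c" "0 < (- of_int k) * t + (1 - c)" if "0 < t" "t < 1" for t
    using map[of t "1/2"] that by (auto simp: Z_shape_def)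
  have c: "0 \<le> c" "0 \<le> of_int k + c" "0 \<le> 1 - c" "0 \<le> - of_int k + (1 - c)"
    using affine_pos_endpoints[OF t(1)] affine_pos_endpoints[OF t(2)] by auto
  then have "k = 0 \<or> k = 1 \<or> k = -1" by linarith
  moreover have False if k: "k = -1"
  proof -
    have "c = 1" using c k by simp
    \<comment> \<open>The reflection fixes t = 1/2, which exceeds both \<open>p\<close> and
      \<open>q\<close>. There y is bounded below, but a point this high is reflected below 0
      whatever \<open>d\<close> is.\<close>
    have "(1/2, \<bar>d\<bar> + 2) \<in> Z_shape p" using p by (simp add: Z_shape_def add_nonneg_pos)
    from map[OF this] have "0 < - (\<bar>d\<bar> + 2) + d"
      using q k \<open>c = 1\<close> by (simp add: Z_shape_def)
    then show False by linarith
  qed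
  moreover have "p = q \<and> c = 0 \<and> d = 0" if k: "k = 1"
  proof -
    have c0: "c = 0" using c k by simp
    have False if "p < q"
    proof -
      \<comment> \<open>The leaf halfway between \<open>p\<close> and \<open>q\<close> is unbounded
        above in the source and bounded above by 1 in the target; for q < p the same happens
        below.\<close>
      have "((p + q) / 2, \<bar>d\<bar> + 2) \<in> Z_shape p" using p q that by (simp add: Z_shape_def add_nonneg_pos)
      from map[OF this] have "\<bar>d\<bar> + 2 + d < 1"
        using that k c0 by (simp add: Z_shape_def)
      then show False by linarith
    qed
    moreover have False if "q < p"
    proof -
      have "((p + q) / 2, - \<bar>d\<bar> - 2) \<in> Z_shape p" using p q that by (simp add: Z_shape_def)
      from map[OF this] have "0 < - \<bar>d\<bar> - 2 + d"
        using that k c0 by (simp add: Z_shape_def)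
      then show False by linarith
    qed
    ultimately have pq: "p = q" by (meson linorder_neqE_linordered_idom)
    \<comment> \<open>Over t = p the window is translated by \<open>d\<close> into itself.\<close>
    have y: "0 < 1 * y + d" "0 < (- 1) * y + (1 - d)" if "0 < y" "y < 1" for y :: real
      using map[of p y] that p k c0 pq by (auto simp: Z_shape_def)
    have "d = 0"
      using affine_pos_endpoints[OF y(1)] affine_pos_endpoints[OF y(2)] by simp
    with pq c0 show ?thesis by simp
  qed
  ultimately show ?thesis by blast
qed

lemma bounded_affine_slope_zero:
  fixes a b :: real
  assumes "\<And>r. r \<ge> 0 \<Longrightarrow> A < a + b * r \<and> a + b * r < B"
  shows "b = 0"
proof (rule ccontr)
  assume b: "b \<noteq> 0"
  define r where "r = (\<bar>A\<bar> + \<bar>B\<bar> + \<bar>a\<bar>) / \<bar>b\<bar>"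
  have "r \<ge> 0" by (simp add: r_def)
  moreover have "\<bar>b * r\<bar> = \<bar>A\<bar> + \<bar>B\<bar> + \<bar>a\<bar>"
    using b by (simp add: r_def abs_mult)
  ultimately show False using assms[of r] assms[of 0] by linarith
qed

section \<open>Rigidity of holomorphic maps\<close>

lemma periodic_holo_linear_combination:
  assumes "periodic_holo X P" "periodic_holo X Q"
  shows "periodic_holo X (\<lambda>w. P w + of_real a * Q w)"
  using assms unfolding periodic_holo_def
  by (intro conjI allI impI continuous_intros holomorphic_intros) simp_all

lemma non_quadratic_direction:
  assumes "non_quadratic \<alpha>" "of_int m * (- \<alpha>) + of_int n * 1 = 0"
  shows "m = 0 \<and> n = 0"
proof -
  have "of_int 0 * \<alpha>\<^sup>2 + of_int (- m) * \<alpha> + of_int n = 0"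
    using assms(2) by simp
  then have "- m = 0 \<and> n = 0"
    using assms(1) unfolding non_quadratic_def by blast
  then show ?thesis by simp
qed

text \<open>The two rays run along different leaves, upwards over t > p and downwards over t < p,
  both in the direction (-\<alpha>, 1), which is nonresonant since \<alpha> is irrational. So the
  side of the bound may depend on the leaf.\<close>

lemma log_region_liouville:
  assumes \<alpha>: "non_quadratic \<alpha>" and p: "0 < p" "p < 1/2" and K: "periodic_holo (log_region \<alpha> p) K"
    and bnd: "\<And>t. 0 < t \<Longrightarrow> t < 1 \<Longrightarrow> \<exists>s A B. \<bar>s\<bar> = 1 \<and> (\<forall>x y \<theta>. (x, y) \<in> log_region \<alpha> p \<longrightarrow> x + \<alpha> * y = t \<longrightarrow>
      s * Re (K (torus_point (x, y) \<theta>)) \<le> A + B * y)"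
  obtains c where "\<And>w. w \<in> tube (log_region \<alpha> p) \<Longrightarrow> K w = c"
proof -
  \<comment> \<open>One leaf on each side of \<open>p\<close>: p < 1/2 < 3/4 and p/2 < p.\<close>
  have t: "(0::real) < 3/4" "3/4 < (1::real)" "0 < p/2" "p/2 < 1" using p by auto
  obtain s1 A1 B1 where b1: "\<bar>s1\<bar> = 1" "\<And>x y \<theta>. (x, y) \<in> log_region \<alpha> p \<Longrightarrow> x + \<alpha> * y = 3/4 \<Longrightarrow>
      s1 * Re (K (torus_point (x, y) \<theta>)) \<le> A1 + B1 * y"
    using bnd[OF t(1,2)] by blast
  obtain s2 A2 B2 where b2: "\<bar>s2\<bar> = 1" "\<And>x y \<theta>. (x, y) \<in> log_region \<alpha> p \<Longrightarrow> x + \<alpha> * y = p/2 \<Longrightarrow>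
      s2 * Re (K (torus_point (x, y) \<theta>)) \<le> A2 + B2 * y"
    using bnd[OF t(3,4)] by blast
  have ray1: "(3/4 - \<alpha> + r * (- \<alpha>), 1 + r * 1) \<in> log_region \<alpha> p" if "r \<ge> 0" for r
    using that p by (simp add: log_region_def Z_shape_def algebra_simps)
  have ray2: "(p/2 - r * (- \<alpha>), 0 - r * 1) \<in> log_region \<alpha> p" if "r \<ge> 0" for r
    using that p by (simp add: log_region_def Z_shape_def algebra_simps)
  show thesis
  proof (rule periodic_holo_liouville[OF K open_log_region connected_log_region ray1 ray2 b1(1) b2(1)])
    fix r :: real and \<theta> :: "real \<times> real" assume r: "r \<ge> 0"
    show "s1 * Re (K (torus_point (3/4 - \<alpha> + r * (- \<alpha>), 1 + r * 1) \<theta>)) \<le> (A1 + B1) + B1 * r"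
      using b1(2)[OF ray1[OF r], of \<theta>] by (simp add: algebra_simps)
    show "s2 * Re (K (torus_point (p/2 - r * (- \<alpha>), 0 - r * 1) \<theta>)) \<le> A2 + (- B2) * r"
      using b2(2)[OF ray2[OF r], of \<theta>] by (simp add: algebra_simps)
  next
    fix m n :: int assume "of_int m * (- \<alpha>) + of_int n * 1 = 0"
    then show "m = 0 \<and> n = 0" by (rule non_quadratic_direction[OF \<alpha>])
  next
    fix c assume "\<And>w. w \<in> tube (log_region \<alpha> p) \<Longrightarrow> K w = c"
    then show thesis by (rule that)
  qed (use p in auto)
qed

text \<open>Source and target parameters are kept separate so that one statement yields both the
  endomorphisms (p = q) and the inequivalence.\<close>

lemma holomorphic_map_rigid:
  assumes \<alpha>: "non_quadratic \<alpha>" and p: "0 < p" "p < 1/2" and q: "0 < q" "q < 1/2"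
    and F: "holomorphic_map_on F (reinhardt_domain \<alpha> p)" "F \<in> reinhardt_domain \<alpha> p \<rightarrow> reinhardt_domain \<alpha> q"
  shows "(\<exists>c. \<forall>z\<in>reinhardt_domain \<alpha> p. F z = c) \<or>
    (p = q \<and> (\<exists>\<omega>\<in>unit_torus. \<forall>z\<in>reinhardt_domain \<alpha> p. F z = rotation \<omega> z))"
proof -
  let ?X = "log_region \<alpha> p"
  have p1: "p < 1" using p by simp
  have FD: "F (exp_map w) \<in> reinhardt_domain \<alpha> q" if "w \<in> tube ?X" for w
    using F(2) that by (auto simp: reinhardt_domain_def)
  have per: "periodic_holo ?X (\<lambda>w. F (exp_map w) $ j)" for j
    by (rule periodic_holo_compose_exp_map[OF F(1) open_reinhardt_domain]) (simp add: reinhardt_domain_def)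
  have nz: "F (exp_map w) $ 1 \<noteq> 0" "F (exp_map w) $ 2 \<noteq> 0" if "w \<in> tube ?X" for w
    using FD[OF that] by (simp_all add: mem_reinhardt_domain)
  note log = periodic_holo_log[OF per open_log_region log_region_starlike(1)[OF p(1) p1] log_region_starlike(2)[OF p(1) p1]]
  obtain P1 and m1 n1 :: int where P1: "periodic_holo ?X P1"
    "\<And>w. w \<in> tube ?X \<Longrightarrow> F (exp_map w) $ 1 = exp (of_int m1 * fst w + of_int n1 * snd w + P1 w)"
    using log[OF _ nz(1)] by blast
  obtain P2 and m2 n2 :: int where P2: "periodic_holo ?X P2"
    "\<And>w. w \<in> tube ?X \<Longrightarrow> F (exp_map w) $ 2 = exp (of_int m2 * fst w + of_int n2 * snd w + P2 w)"
    using log[OF _ nz(2)] by blast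
  \<comment> \<open>The t-coordinate of the image is
    \<open>\<mu> * x + \<nu> * y + Re K\<close>.\<close>
  define \<mu> \<nu> where "\<mu> = of_int m1 + \<alpha> * of_int m2" and "\<nu> = of_int n1 + \<alpha> * of_int n2"
  define K where "K w = P1 w + of_real \<alpha> * P2 w" for w
  have K: "periodic_holo ?X K"
    unfolding K_def by (rule periodic_holo_linear_combination[OF P1(1) P2(1)])
  have shape: "(\<mu> * x + \<nu> * y + Re (K (torus_point (x, y) \<theta>)),
      of_int m2 * x + of_int n2 * y + Re (P2 (torus_point (x, y) \<theta>))) \<in> Z_shape q"
    if xy: "(x, y) \<in> ?X" for x y \<theta>
  proof -
    have w: "torus_point (x, y) \<theta> \<in> tube ?X" using xy by (simp add: torus_point_in_tube)
    have "(ln (cmod (F (exp_map (torus_point (x, y) \<theta>)) $ 1)), ln (cmod (F (exp_map (torus_point (x, y) \<theta>)) $ 2))) \<in> log_region \<alpha> q"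
      using FD[OF w] by (simp add: mem_reinhardt_domain)
    then have "(m1 * x + n1 * y + Re (P1 (torus_point (x, y) \<theta>)), m2 * x + n2 * y + Re (P2 (torus_point (x, y) \<theta>))) \<in> log_region \<alpha> q"
      unfolding P1(2)[OF w] P2(2)[OF w] by (simp add: norm_exp_eq_Re torus_point_def)
    then show ?thesis
      by (simp add: log_region_def K_def \<mu>_def \<nu>_def algebra_simps)
  qed
  have "\<exists>s A B. \<bar>s\<bar> = 1 \<and> (\<forall>x y \<theta>. (x, y) \<in> ?X \<longrightarrow> x + \<alpha> * y = t \<longrightarrow>
      s * Re (K (torus_point (x, y) \<theta>)) \<le> A + B * y)" if "0 < t" "t < 1" for t
  proof -
    \<comment> \<open>The image has t < 1, and on the leaf x = t - \<alpha> y.\<close>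
    have "1 * Re (K (torus_point (x, y) \<theta>)) \<le> (1 - \<mu> * t) + (\<mu> * \<alpha> - \<nu>) * y" if "(x, y) \<in> ?X" "x + \<alpha> * y = t" for x y \<theta>
    proof -
      have "\<mu> * x + \<nu> * y + Re (K (torus_point (x, y) \<theta>)) < 1"
        using shape[OF that(1), of \<theta>] by (simp add: Z_shape_def)
      then show ?thesis using that(2) by (auto simp: algebra_simps)
    qed
    then show ?thesis
      by (intro exI[of _ 1] exI[of _ "1 - \<mu> * t"] exI[of _ "\<mu> * \<alpha> - \<nu>"]) auto
  qed
  then obtain c where c: "\<And>w. w \<in> tube ?X \<Longrightarrow> K w = c"
    using log_region_liouville[OF \<alpha> p K] by blast
  have c': "Re (K (torus_point (x, y) \<theta>)) = Re c" if "(x, y) \<in> ?X" for x y \<theta>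
    using c that by (simp add: torus_point_in_tube)
  \<comment> \<open>With \<open>K\<close> constant, the t-coordinate of the image is affine along
    the upward ray with this slope, yet stays in (0, 1). Expanding the slope gives an integer
    quadratic relation for \<alpha>.\<close>
  have "\<nu> - \<mu> * \<alpha> = 0"
  proof (rule bounded_affine_slope_zero)
    fix r :: real assume r: "r \<ge> 0"
    have "(3/4 - \<alpha> + r * (- \<alpha>), 1 + r * 1) \<in> ?X"
      using r p by (simp add: log_region_def Z_shape_def algebra_simps)
    from shape[OF this, of "(0,0)"] c'[OF this, of "(0,0)"]
    show "0 < (\<mu> * (3/4 - \<alpha>) + \<nu> + Re c) + (\<nu> - \<mu> * \<alpha>) * r \<and> (\<mu> * (3/4 - \<alpha>) + \<nu> + Re c) + (\<nu> - \<mu> * \<alpha>) * r < 1"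
      by (auto simp: Z_shape_def algebra_simps)
  qed
  then have "of_int m2 * \<alpha>\<^sup>2 + of_int (m1 - n2) * \<alpha> + of_int (- n1) = 0"
    by (simp add: \<mu>_def \<nu>_def algebra_simps power2_eq_square)
  then have "m2 = 0 \<and> m1 - n2 = 0 \<and> - n1 = 0"
    using \<alpha> unfolding non_quadratic_def by blast
  then have M: "m2 = 0" "n2 = m1" "n1 = 0" by auto
  define k where "k = m1"
  have \<mu>\<nu>: "\<mu> = of_int k" "\<nu> = of_int k * \<alpha>" by (simp_all add: \<mu>_def \<nu>_def M k_def)
  have shape': "(of_int k * (x + \<alpha> * y) + Re c, of_int k * y + Re (P2 (torus_point (x, y) \<theta>))) \<in> Z_shape q"
    if xy: "(x, y) \<in> ?X" for x y \<theta>
    using shape[OF xy, of \<theta>] c'[OF xy, of \<theta>] unfolding \<mu>\<nu> M k_def by (simp add: algebra_simps)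
  \<comment> \<open>The whole leaf t goes to the leaf \<open>of_int k * t + Re c\<close>, and the
    position of that leaf relative to \<open>q\<close> decides whether y is bounded above by 1 or
    below by 0 there.\<close>
  have "\<exists>s A B. \<bar>s\<bar> = 1 \<and> (\<forall>x y \<theta>. (x, y) \<in> ?X \<longrightarrow> x + \<alpha> * y = t \<longrightarrow>
      s * Re (P2 (torus_point (x, y) \<theta>)) \<le> A + B * y)" for t
    proof (cases "of_int k * t + Re c < q")
      case True
      have "1 * Re (P2 (torus_point (x, y) \<theta>)) \<le> 1 + (- of_int k) * y" if "(x, y) \<in> ?X" "x + \<alpha> * y = t" for x y \<theta>
        using shape'[OF that(1), of \<theta>] True unfolding that(2) by (simp add: Z_shape_def)
      then show ?thesis by (intro exI[of _ 1] exI[of _ 1] exI[of _ "- of_int k"]) auto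
    next
      case False
      have "-1 * Re (P2 (torus_point (x, y) \<theta>)) \<le> 0 + of_int k * y" if "(x, y) \<in> ?X" "x + \<alpha> * y = t" for x y \<theta>
        using shape'[OF that(1), of \<theta>] False unfolding that(2) by (simp add: Z_shape_def)
      then show ?thesis by (intro exI[of _ "-1"] exI[of _ 0] exI[of _ "of_int k"]) auto
    qed
  then obtain d where d: "\<And>w. w \<in> tube ?X \<Longrightarrow> P2 w = d"
    using log_region_liouville[OF \<alpha> p P2(1)] by blast
  have F1: "F (exp_map w) $ 1 = exp (of_int k * fst w + (c - of_real \<alpha> * d))" if "w \<in> tube ?X" for w
  proof -
    have "P1 w = c - of_real \<alpha> * d"
      using c[OF that] d[OF that] by (simp add: K_def eq_diff_eq)
    then show ?thesis
      using P1(2)[OF that] by (simp add: M k_def)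
  qed
  have F2: "F (exp_map w) $ 2 = exp (of_int k * snd w + d)" if "w \<in> tube ?X" for w
    using P2(2)[OF that] d[OF that] by (simp add: M k_def)
  have "(of_int k * t + Re c, of_int k * y + Re d) \<in> Z_shape q" if "(t, y) \<in> Z_shape p" for t y
  proof -
    have xy: "(t - \<alpha> * y, y) \<in> ?X" using that by (simp add: log_region_def)
    then have "P2 (torus_point (t - \<alpha> * y, y) (0,0)) = d"
      by (intro d) (simp add: torus_point_in_tube)
    with shape'[OF xy, of "(0,0)"] show ?thesis by simp
  qed
  from Z_shape_affine[OF p q this] show ?thesis
  proof
    assume "k = 0"
    then have "F z = (\<chi> i. if i = 1 then exp (c - of_real \<alpha> * d) else exp d)" if "z \<in> reinhardt_domain \<alpha> p" for z
      using that F1 F2 by (auto simp: reinhardt_domain_def vec_eq_iff forall_2)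
    then show ?thesis by blast
  next
    assume *: "k = 1 \<and> p = q \<and> Re c = 0 \<and> Re d = 0"
    define \<omega> :: "complex ^ 2" where "\<omega> = (\<chi> i. if i = 1 then exp (c - of_real \<alpha> * d) else exp d)"
    have "\<omega> \<in> unit_torus"
      using * by (simp add: unit_torus_def \<omega>_def norm_exp_eq_Re)
    moreover have "F z = rotation \<omega> z" if "z \<in> reinhardt_domain \<alpha> p" for z
      using that F1 F2 * by (auto simp: reinhardt_domain_def vec_eq_iff forall_2 rotation_def \<omega>_def exp_add)
    ultimately show ?thesis using * by blast
  qed
qed

section \<open>Failure of pseudoconvexity\<close>

text \<open>
  For \<open>\<epsilon> = 0\<close> the centre lies over the reentrant corner \<open>(t, y) = (p, 1)\<close>, and \<open>\<epsilon>\<close> lowers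
  \<open>y\<close> by \<open>\<epsilon>\<close> at fixed \<open>t\<close>. The unequal slopes 2 and 1 make the disc meet the complement only
  at the centre: for \<open>\<zeta> \<noteq> 0\<close>, \<open>\<bar>1 + \<zeta>\<bar> \<ge> 1\<close> implies \<open>\<bar>1 + 2 \<zeta>\<bar> > 1\<close>.
\<close>

definition contact_disc :: "real \<Rightarrow> real \<Rightarrow> real \<Rightarrow> complex \<Rightarrow> complex ^ 2" where
  "contact_disc \<alpha> p \<epsilon> \<zeta> =
    (\<chi> i. if i = 1 then of_real (exp (p - \<alpha> + \<alpha> * \<epsilon>)) * (1 + 2 * \<zeta>) else of_real (exp (1 - \<epsilon>)) * (1 + \<zeta>))"

lemma contact_disc_nth [simp]:
  "contact_disc \<alpha> p \<epsilon> \<zeta> $ 1 = of_real (exp (p - \<alpha> + \<alpha> * \<epsilon>)) * (1 + 2 * \<zeta>)"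
  "contact_disc \<alpha> p \<epsilon> \<zeta> $ 2 = of_real (exp (1 - \<epsilon>)) * (1 + \<zeta>)"
  by (simp_all add: contact_disc_def)

text \<open>The term \<open>\<alpha> * \<epsilon>\<close> in the first exponent cancels the effect
  of lowering y, so t does not depend on \<open>\<epsilon>\<close>.\<close>

lemma contact_disc_mem_iff:
  assumes "1 + 2 * \<zeta> \<noteq> 0" "1 + \<zeta> \<noteq> 0"
  shows "contact_disc \<alpha> p \<epsilon> \<zeta> \<in> reinhardt_domain \<alpha> p \<longleftrightarrow>
    (p + ln (cmod (1 + 2 * \<zeta>)) + \<alpha> * ln (cmod (1 + \<zeta>)), 1 - \<epsilon> + ln (cmod (1 + \<zeta>))) \<in> Z_shape p"
proof -
  have "ln (cmod (contact_disc \<alpha> p \<epsilon> \<zeta> $ 1)) = p - \<alpha> + \<alpha> * \<epsilon> + ln (cmod (1 + 2 * \<zeta>))"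
    "ln (cmod (contact_disc \<alpha> p \<epsilon> \<zeta> $ 2)) = 1 - \<epsilon> + ln (cmod (1 + \<zeta>))"
    using assms by (simp_all add: norm_mult ln_mult del: of_real_exp)
  moreover have "contact_disc \<alpha> p \<epsilon> \<zeta> $ 1 \<noteq> 0" "contact_disc \<alpha> p \<epsilon> \<zeta> $ 2 \<noteq> 0"
    using assms by auto
  moreover have "p - \<alpha> + \<alpha> * \<epsilon> + ln (cmod (1 + 2 * \<zeta>)) + \<alpha> * (1 - \<epsilon> + ln (cmod (1 + \<zeta>))) =
      p + ln (cmod (1 + 2 * \<zeta>)) + \<alpha> * ln (cmod (1 + \<zeta>))"
    by (simp add: algebra_simps)
  ultimately show ?thesis
    unfolding mem_reinhardt_domain log_region_def by (simp only: mem_Collect_eq prod.case) blast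
qed

lemma norm_one_plus_sq: "(cmod (1 + of_real a * \<zeta>))\<^sup>2 = 1 + 2 * a * Re \<zeta> + a\<^sup>2 * (cmod \<zeta>)\<^sup>2"
  unfolding cmod_power2 by (simp add: algebra_simps power2_eq_square)

text \<open>Either y < 1, or \<open>\<epsilon> \<le> L2 \<zeta>\<close> and the unequal slopes give
  t > p. The radius is the same for all \<open>\<epsilon>\<close>, so that the boundary circles form
  a compact family.\<close>

lemma contact_disc_in_domain:
  assumes \<alpha>: "0 < \<alpha>" and p: "0 < p" "p < 1"
  obtains r where "0 < r" "\<And>\<epsilon> \<zeta>. 0 \<le> \<epsilon> \<Longrightarrow> \<epsilon> \<le> 1/4 \<Longrightarrow> cmod \<zeta> \<le> r \<Longrightarrow> 0 < \<epsilon> \<or> \<zeta> \<noteq> 0 \<Longrightarrow>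
    contact_disc \<alpha> p \<epsilon> \<zeta> \<in> reinhardt_domain \<alpha> p"
proof -
  define L1 L2 where "L1 \<zeta> = ln (cmod (1 + 2 * \<zeta>))" and "L2 \<zeta> = ln (cmod (1 + \<zeta>))" for \<zeta>
  have "isCont (\<lambda>\<zeta>. p + L1 \<zeta> + \<alpha> * L2 \<zeta>) 0" "isCont L2 0"
    unfolding L1_def L2_def by (intro continuous_intros; simp)+
  then have "((\<lambda>\<zeta>. p + L1 \<zeta> + \<alpha> * L2 \<zeta>) \<longlongrightarrow> p) (nhds 0)" "(L2 \<longlongrightarrow> 0) (nhds 0)"
    unfolding isCont_def tendsto_nhds_iff by (simp_all add: L1_def L2_def)
  \<comment> \<open>The last bound, with \<open>\<epsilon> \<le> 1/4\<close>, keeps y above 1/2, so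
    only the corner condition remains to be checked.\<close>
  then have "\<forall>\<^sub>F \<zeta> in nhds 0. 0 < p + L1 \<zeta> + \<alpha> * L2 \<zeta> \<and> p + L1 \<zeta> + \<alpha> * L2 \<zeta> < 1 \<and> - 1/4 < L2 \<zeta>"
    using p by (intro eventually_conj order_tendstoD) auto
  then obtain \<delta> where \<delta>: "\<delta> > 0" "\<And>\<zeta>. cmod \<zeta> < \<delta> \<Longrightarrow> 0 < p + L1 \<zeta> + \<alpha> * L2 \<zeta> \<and> p + L1 \<zeta> + \<alpha> * L2 \<zeta> < 1 \<and> - 1/4 < L2 \<zeta>"
    unfolding eventually_nhds_metric by (auto simp: dist_norm)
  define r where "r = min (1/4) (\<delta> / 2)"
  show thesis
  proof (rule that)
    show "0 < r" using \<delta> by (simp add: r_def)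
    fix \<epsilon> :: real and \<zeta> assume \<epsilon>: "0 \<le> \<epsilon>" "\<epsilon> \<le> 1/4" and \<zeta>: "cmod \<zeta> \<le> r" and *: "0 < \<epsilon> \<or> \<zeta> \<noteq> 0"
    have small: "cmod \<zeta> \<le> 1/4" "cmod \<zeta> < \<delta>"
      using \<zeta> \<delta>(1) by (auto simp: r_def)
    have nz: "1 + 2 * \<zeta> \<noteq> 0" "1 + \<zeta> \<noteq> 0"
    proof -
      have "cmod (2 * \<zeta>) < 1" "cmod \<zeta> < 1" using small by (auto simp: norm_mult)
      then show "1 + 2 * \<zeta> \<noteq> 0" "1 + \<zeta> \<noteq> 0"
        by (metis add.inverse_unique norm_minus_cancel norm_one order_less_irrefl)+
    qed
    have "0 < L1 \<zeta>" "0 \<le> L2 \<zeta>" if "\<epsilon> \<le> L2 \<zeta>"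
    proof -
      show L2: "0 \<le> L2 \<zeta>" using that \<epsilon> by simp
      have le: "(if 0 < \<epsilon> then 1 < cmod (1 + \<zeta>) else 1 \<le> cmod (1 + \<zeta>))"
      proof -
        have "exp \<epsilon> \<le> cmod (1 + \<zeta>)" using that nz by (simp add: L2_def ln_ge_iff)
        moreover have "1 \<le> exp \<epsilon>" "0 < \<epsilon> \<longrightarrow> 1 < exp \<epsilon>" using \<epsilon> by auto
        ultimately show ?thesis by argo
      qed
      have sq1: "(cmod (1 + \<zeta>))\<^sup>2 = 1 + 2 * Re \<zeta> + (cmod \<zeta>)\<^sup>2"
        using norm_one_plus_sq[of 1 \<zeta>] by simp
      have sq2: "(cmod (1 + 2 * \<zeta>))\<^sup>2 = 1 + 4 * Re \<zeta> + 4 * (cmod \<zeta>)\<^sup>2"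
        using norm_one_plus_sq[of 2 \<zeta>] by simp
      have "1 < (cmod (1 + 2 * \<zeta>))\<^sup>2"
      \<comment> \<open>At the centre \<open>\<epsilon>\<close> is positive, and \<open>le\<close>
        would say 1 < 1.\<close>
      proof (cases "\<zeta> = 0")
        case True
        then show ?thesis using le * by simp
      next
        case False
        have "1 \<le> cmod (1 + \<zeta>)" using le by (auto split: if_splits)
        then have "1 \<le> (cmod (1 + \<zeta>))\<^sup>2" by (simp add: one_le_power)
        moreover have "0 < (cmod \<zeta>)\<^sup>2" using False by simp
        ultimately show ?thesis unfolding sq1 sq2 by linarith
      qed
      then have "1 < cmod (1 + 2 * \<zeta>)"
        by (metis norm_ge_zero one_power2 power2_less_imp_less)
      then show "0 < L1 \<zeta>" unfolding L1_def by (rule ln_gt_zero)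
    qed
    then have "p < p + L1 \<zeta> + \<alpha> * L2 \<zeta> \<or> 1 - \<epsilon> + L2 \<zeta> < 1"
      using \<alpha> by (cases "\<epsilon> \<le> L2 \<zeta>") (auto intro: add_pos_nonneg)
    then show "contact_disc \<alpha> p \<epsilon> \<zeta> \<in> reinhardt_domain \<alpha> p"
      unfolding contact_disc_mem_iff[OF nz] L1_def[symmetric] unfolding L2_def[symmetric]
      using \<delta>(2)[OF small(2)] \<epsilon> by (auto simp: Z_shape_def)
  qed
qed

lemma contact_disc_centre_notin: "contact_disc \<alpha> p 0 0 \<notin> reinhardt_domain \<alpha> p"
  using contact_disc_mem_iff[of 0 \<alpha> p 0] by (simp add: Z_shape_def)

lemma continuous_on_contact_disc:
  assumes "continuous_on A f" "continuous_on A g"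
  shows "continuous_on A (\<lambda>x. contact_disc \<alpha> p (f x) (g x))"
  unfolding contact_disc_def
proof (rule continuous_on_vec_lambda)
  fix i :: 2
  have "continuous_on A (\<lambda>x. of_real (exp (p - \<alpha> + \<alpha> * f x)) * (1 + 2 * g x))"
    "continuous_on A (\<lambda>x. of_real (exp (1 - f x)) * (1 + g x))"
    by (intro continuous_intros assms)+
  then show "continuous_on A (\<lambda>x. if i = 1 then of_real (exp (p - \<alpha> + \<alpha> * f x)) * (1 + 2 * g x) else of_real (exp (1 - f x)) * (1 + g x))"
    by (cases "i = 1") simp_all
qed

text \<open>Continuity principle: the boundary circles stay in a compact subset of the domain, so
  the sub-mean value inequality bounds \<open>u\<close> at the centres for
  \<open>\<epsilon> > 0\<close>. These converge to a point outside the domain, which an exhaustion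
  function forbids.\<close>

lemma not_pseudoconvex_reinhardt_domain:
  assumes \<alpha>: "0 < \<alpha>" and p: "0 < p" "p < 1"
  shows "\<not> pseudoconvex (reinhardt_domain \<alpha> p)"
proof
  let ?D = "reinhardt_domain \<alpha> p"
  assume "pseudoconvex ?D"
  then obtain u where u: "continuous_on ?D u"
    and psh: "\<And>z w. (\<And>\<zeta>. cmod \<zeta> \<le> 1 \<Longrightarrow> z + \<zeta> *s w \<in> ?D) \<Longrightarrow>
        u z \<le> 1 / (2 * pi) * integral {0..2 * pi} (\<lambda>t. u (z + cis t *s w))"
    and exh: "\<And>c. closure {z \<in> ?D. u z < c} \<subseteq> ?D"
    unfolding pseudoconvex_def continuous_psh_on_def by blast
  obtain r where r: "0 < r" and disc: "\<And>\<epsilon> \<zeta>. 0 \<le> \<epsilon> \<Longrightarrow> \<epsilon> \<le> 1/4 \<Longrightarrow> cmod \<zeta> \<le> r \<Longrightarrow> 0 < \<epsilon> \<or> \<zeta> \<noteq> 0 \<Longrightarrow>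
      contact_disc \<alpha> p \<epsilon> \<zeta> \<in> ?D"
    using contact_disc_in_domain[OF assms] by blast
  \<comment> \<open>Including \<open>\<epsilon> = 0\<close> makes the family compact; its circle
    still lies in the domain, since only the centre leaves it.\<close>
  define S where "S = (\<lambda>x. contact_disc \<alpha> p (fst x) (snd x)) ` ({0..1/4} \<times> sphere 0 r)"
  have "compact S"
    unfolding S_def
    by (intro compact_continuous_image continuous_on_contact_disc continuous_on_fst continuous_on_snd
        continuous_on_id compact_Times compact_Icc compact_sphere)
  moreover have "S \<subseteq> ?D"
    unfolding S_def using r by (auto intro!: disc)
  ultimately have "bounded (u ` S)"
    by (intro compact_imp_bounded compact_continuous_image continuous_on_subset[OF u])
  then obtain M where M: "\<And>z. z \<in> S \<Longrightarrow> u z \<le> M"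
    unfolding bounded_real by (meson abs_le_D1 image_eqI)
  have centre: "contact_disc \<alpha> p \<epsilon> 0 \<in> {z \<in> ?D. u z < M + 1}" if \<epsilon>: "0 < \<epsilon>" "\<epsilon> \<le> 1/4" for \<epsilon>
  proof -
    let ?z = "contact_disc \<alpha> p \<epsilon> 0"
    \<comment> \<open>The derivative of the disc in \<open>\<zeta>\<close> times \<open>r\<close>,
      so that the unit disc in direction \<open>w\<close> is the contact disc of radius
      \<open>r\<close>.\<close>
    define w :: "complex ^ 2" where
      "w = (\<chi> i. if i = 1 then 2 * of_real (exp (p - \<alpha> + \<alpha> * \<epsilon>)) * of_real r else of_real (exp (1 - \<epsilon>)) * of_real r)"
    have eq: "?z + \<zeta> *s w = contact_disc \<alpha> p \<epsilon> (of_real r * \<zeta>)" for \<zeta>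
      by (simp add: vec_eq_iff forall_2 w_def algebra_simps)
    have inD: "?z + \<zeta> *s w \<in> ?D" if "cmod \<zeta> \<le> 1" for \<zeta>
      unfolding eq using that \<epsilon> r by (intro disc) (auto simp: norm_mult mult_left_le)
    have inS: "?z + cis t *s w \<in> S" for t
      unfolding eq S_def using \<epsilon> r by (intro image_eqI[of _ _ "(\<epsilon>, of_real r * cis t)"]) (auto simp: norm_mult)
    have "continuous_on {0..2*pi} (\<lambda>t. u (?z + cis t *s w))"
    proof (rule continuous_on_compose2[OF u])
      show "continuous_on {0..2*pi} (\<lambda>t. ?z + cis t *s w)"
        unfolding eq by (intro continuous_on_contact_disc continuous_intros)
    qed (use inD in auto)
    then have "(\<lambda>t. u (?z + cis t *s w)) integrable_on {0..2*pi}"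
      by (rule integrable_continuous_real)
    then have "integral {0..2*pi} (\<lambda>t. u (?z + cis t *s w)) \<le> integral {0..2*pi} (\<lambda>t. M)"
      by (rule integral_le) (use inS M in auto)
    then have "1 / (2 * pi) * integral {0..2*pi} (\<lambda>t. u (?z + cis t *s w)) \<le> 1 / (2 * pi) * (2 * pi * M)"
      by (intro mult_left_mono) auto
    with psh[OF inD] have "u ?z \<le> 1 / (2 * pi) * (2 * pi * M)"
      by (rule order_trans)
    then have "u ?z \<le> M" by simp
    moreover have "?z \<in> ?D" using inD[of 0] by simp
    ultimately show ?thesis by simp
  qed
  have "continuous_on UNIV (\<lambda>\<epsilon>. contact_disc \<alpha> p \<epsilon> 0)"
    by (intro continuous_on_contact_disc continuous_intros)
  then have "((\<lambda>\<epsilon>. contact_disc \<alpha> p \<epsilon> 0) \<longlongrightarrow> contact_disc \<alpha> p 0 0) (at_right 0)"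
    by (simp add: continuous_on_def filterlim_at_split)
  moreover have "\<forall>\<^sub>F \<epsilon> in at_right 0. contact_disc \<alpha> p \<epsilon> 0 \<in> closure {z \<in> ?D. u z < M + 1}"
    unfolding eventually_at_right_field
  proof (intro exI[of _ "1/4"] conjI allI impI)
    fix \<epsilon> :: real assume "0 < \<epsilon>" "\<epsilon> < 1/4"
    then show "contact_disc \<alpha> p \<epsilon> 0 \<in> closure {z \<in> ?D. u z < M + 1}"
      by (intro subsetD[OF closure_subset] centre) auto
  qed simp
  ultimately have "contact_disc \<alpha> p 0 0 \<in> closure {z \<in> ?D. u z < M + 1}"
    by (intro Lim_in_closed_set[OF closed_closure _ trivial_limit_at_right_real])
  with exh contact_disc_centre_notin show False by blast
qed

section \<open>Endomorphisms and inequivalence\<close>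

lemma holomorphic_map_on_rotation:
  fixes \<omega> :: "complex ^ 'n"
  shows "holomorphic_map_on (restrict (rotation \<omega>) D) D"
  unfolding holomorphic_map_on_def
proof
  fix z assume z: "z \<in> D"
  define A :: "complex ^ 'n ^ 'n" where "A = (\<chi> i j. if i = j then \<omega> $ i else 0)"
  have "rotation \<omega> = (\<lambda>h. A *v h)"
    by (simp add: fun_eq_iff vec_eq_iff rotation_def A_def matrix_vector_mult_def if_distrib[of "\<lambda>x. x * _"] cong: if_cong)
  moreover have "((\<lambda>h. A *v h) has_derivative (\<lambda>h. A *v h)) (at z within D)"
    by (intro bounded_linear_imp_has_derivative matrix_vector_mul_bounded_linear)
  ultimately show "\<exists>A. (restrict (rotation \<omega>) D has_derivative (\<lambda>h. A *v h)) (at z within D)"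
    using has_derivative_transform[OF z, of "restrict (rotation \<omega>) D" "rotation \<omega>"] by auto
qed

lemma holomorphic_map_on_const: "holomorphic_map_on (restrict (\<lambda>_. c) D) D"
  unfolding holomorphic_map_on_def
proof
  fix z assume z: "z \<in> D"
  have "((\<lambda>_. c) has_derivative (\<lambda>h. 0 *v h)) (at z within D)"
    by simp
  then show "\<exists>A. (restrict (\<lambda>_. c) D has_derivative (\<lambda>h. A *v h)) (at z within D)"
    using has_derivative_transform[OF z, of "restrict (\<lambda>_. c) D" "\<lambda>_. c"] by (metis restrict_apply')
qed

lemma holo_End_reinhardt_domain:
  assumes \<alpha>: "non_quadratic \<alpha>" and p: "0 < p" "p < 1/2"
  shows "holo_End (reinhardt_domain \<alpha> p) =
    {restrict (rotation \<omega>) (reinhardt_domain \<alpha> p) |\<omega>. \<omega> \<in> unit_torus}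
    \<union> {restrict (\<lambda>_. c) (reinhardt_domain \<alpha> p) |c. c \<in> reinhardt_domain \<alpha> p}"
    (is "holo_End ?D = ?R \<union> ?C")
proof
  show "holo_End ?D \<subseteq> ?R \<union> ?C"
  proof
    fix f assume f: "f \<in> holo_End ?D"
    then have fD: "f \<in> ?D \<rightarrow> ?D" "f \<in> extensional ?D" and hol: "holomorphic_map_on f ?D"
      by (auto simp: holo_End_def PiE_def)
    from holomorphic_map_rigid[OF \<alpha> p p hol fD(1)]
    consider c where "\<And>z. z \<in> ?D \<Longrightarrow> f z = c" | \<omega> where "\<omega> \<in> unit_torus" "\<And>z. z \<in> ?D \<Longrightarrow> f z = rotation \<omega> z"
      by blast
    then show "f \<in> ?R \<union> ?C"
    proof cases
      case (1 c)
      obtain z where z: "z \<in> ?D"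
        using domain_reinhardt_domain[of p \<alpha>] p by (auto simp: domain_in_Cn_def)
      have "c \<in> ?D" using fD(1) z 1 by auto
      moreover have "f = restrict (\<lambda>_. c) ?D"
        by (rule extensionalityI[OF fD(2) restrict_extensional]) (simp add: 1)
      ultimately show ?thesis by blast
    next
      case (2 \<omega>)
      have "f = restrict (rotation \<omega>) ?D"
        by (rule extensionalityI[OF fD(2) restrict_extensional]) (simp add: 2)
      with 2(1) show ?thesis by blast
    qed
  qed
  show "?R \<union> ?C \<subseteq> holo_End ?D"
    using Reinhardt_reinhardt_domain[of \<alpha> p] holomorphic_map_on_rotation holomorphic_map_on_const
    by (auto simp: holo_End_def Reinhardt_def)
qed

text \<open>For distinct parameters rigidity leaves only constants, which do not separate a point
  \<open>z\<close> from its reflection \<open>z'\<close>.\<close>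

lemma biholomorphic_reinhardt_domain:
  assumes \<alpha>: "non_quadratic \<alpha>" and p: "0 < p" "p < 1/2" and q: "0 < q" "q < 1/2"
    and "biholomorphic (reinhardt_domain \<alpha> p) (reinhardt_domain \<alpha> q)"
  shows "p = q"
proof -
  let ?D = "reinhardt_domain \<alpha> p"
  obtain f where f: "bij_betw f ?D (reinhardt_domain \<alpha> q)" "holomorphic_map_on f ?D"
    using assms(6) unfolding biholomorphic_def by blast
  obtain z where z: "z \<in> ?D"
    using domain_reinhardt_domain[of p \<alpha>] p by (auto simp: domain_in_Cn_def)
  define z' where "z' = rotation (\<chi> i. -1) z"
  have z': "z' \<in> ?D"
    using Reinhardt_reinhardt_domain[of \<alpha> p] z by (simp add: Reinhardt_def z'_def unit_torus_def)
  have "z' $ 1 \<noteq> z $ 1"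
    using z by (simp add: z'_def rotation_def mem_reinhardt_domain)
  then have "f z' \<noteq> f z"
    using f(1) z z' by (metis bij_betw_imp_inj_on inj_onD)
  moreover have "f \<in> ?D \<rightarrow> reinhardt_domain \<alpha> q"
    using f(1) by (rule bij_betw_imp_funcset)
  ultimately show ?thesis
    using holomorphic_map_rigid[OF \<alpha> p q f(2)] z z' by metis
qed

text \<open>Carries uncountability from the parameters to the domains. The height 2 over a leaf
  between p < q is allowed in the upper arm for \<open>p\<close> and forbidden for
  \<open>q\<close>.\<close>

lemma inj_on_reinhardt_domain: "inj_on (reinhardt_domain \<alpha>) {0<..<1/2}"
proof (rule linorder_inj_onI)
  fix p q :: real assume pq: "p < q" "p \<in> {0<..<1/2}" "q \<in> {0<..<1/2}"
  define w :: "complex \<times> complex" where "w = (of_real ((p + q) / 2 - \<alpha> * 2), of_real 2)"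
  have iff: "exp_map w \<in> reinhardt_domain \<alpha> s \<longleftrightarrow> ((p + q) / 2, 2) \<in> Z_shape s" for s
    by (simp add: mem_reinhardt_domain norm_exp_eq_Re w_def log_region_def)
  have "exp_map w \<in> reinhardt_domain \<alpha> p" "exp_map w \<notin> reinhardt_domain \<alpha> q"
    unfolding iff using pq by (auto simp: Z_shape_def)
  then show "reinhardt_domain \<alpha> p \<noteq> reinhardt_domain \<alpha> q" by blast
qed (rule linear)

theorem theorem7p1:
  "\<exists>\<D> :: (complex ^ 2) set set.
     uncountable \<D> \<and>
     pairwise (\<lambda>D E. \<not> biholomorphic D E) \<D> \<and>
     (\<forall>D\<in>\<D>. domain_in_Cn D \<and> Reinhardt D \<and> \<not> pseudoconvex D \<and>
        holo_End D = {restrict (rotation \<omega>) D |\<omega>. \<omega> \<in> unit_torus}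
                   \<union> {restrict (\<lambda>_. c) D |c. c \<in> D})"
proof -
  obtain \<alpha> where \<alpha>: "0 < \<alpha>" "non_quadratic \<alpha>"
    using ex_non_quadratic by blast
  let ?\<D> = "reinhardt_domain \<alpha> ` {0<..<1/2}"
  have uncountable: "uncountable ?\<D>"
    using inj_on_reinhardt_domain[of \<alpha>] uncountable_open_interval[of 0 "1/2"]
    by (auto dest: countable_image_inj_on)
  have pairwise: "pairwise (\<lambda>D E. \<not> biholomorphic D E) ?\<D>"
  proof (rule pairwiseI)
    fix D E assume "D \<in> ?\<D>" "E \<in> ?\<D>" "D \<noteq> E"
    then obtain p q where "p \<in> {0<..<1/2}" "q \<in> {0<..<1/2}" "p \<noteq> q"
      "D = reinhardt_domain \<alpha> p" "E = reinhardt_domain \<alpha> q"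
      by blast
    then show "\<not> biholomorphic D E"
      using biholomorphic_reinhardt_domain[OF \<alpha>(2), of p q] by auto
  qed
  have "\<forall>D\<in>?\<D>. domain_in_Cn D \<and> Reinhardt D \<and> \<not> pseudoconvex D \<and>
        holo_End D = {restrict (rotation \<omega>) D |\<omega>. \<omega> \<in> unit_torus} \<union> {restrict (\<lambda>_. c) D |c. c \<in> D}"
  proof
    fix D assume "D \<in> ?\<D>"
    then obtain p where p: "0 < p" "p < 1/2" and D: "D = reinhardt_domain \<alpha> p"
      by auto
    have "p < 1" using p by simp
    then show "domain_in_Cn D \<and> Reinhardt D \<and> \<not> pseudoconvex D \<and>
        holo_End D = {restrict (rotation \<omega>) D |\<omega>. \<omega> \<in> unit_torus} \<union> {restrict (\<lambda>_. c) D |c. c \<in> D}"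
      unfolding D
      using domain_reinhardt_domain[OF p(1)] Reinhardt_reinhardt_domain not_pseudoconvex_reinhardt_domain[OF \<alpha>(1) p(1)]
        holo_End_reinhardt_domain[OF \<alpha>(2) p] by blast
  qed
  with uncountable pairwise show ?thesis
    by (intro exI[of _ ?\<D>] conjI)
qed

end
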